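(* Let $\mathbb{H}=\{(z_1,z_2)\in\mathbb{C}^2 : |z_1|<|z_2|<1\}$ be the Hartogs triangle. The Friedrichs operator \[ \mathbf{F}:A^2(\mathbb{H})\to A^p(\mathbb{H}) \] is bounded for every $p\in[2,4)$, whereas the Bergman projection $\mathbf{B}$ does not map $L^2(\mathbb{H})$ into $A^p(\mathbb{H})$ for any $p>2$.
   Context: For a bounded domain $\Omega\subset\mathbb{C}^n$, $\mathcal{O}(\Omega)$ is the space of holomorphic functions on $\Omega$, and for $1\le p<\infty$, $A^p(\Omega)=L^p(\Omega)\cap\mathcal{O}(\Omega)$ (with respect to Lebesgue measure, with the $L^p$ norm). The Bergman projection $\mathbf{B}$ is the orthogonal projection from $L^2(\Omega)$ onto $A^2(\Omega)$. The Friedrichs operator is the conjugate-linear map $\mathbf{F}:A^2(\Omega)\to A^2(\Omega)$, $\mathbf{F}(g)=\mathbf{B}(\overline{g})$. An operator $T:X\to Y$ is bounded if it maps $X$ into $Y$ with $\|Tx\|_Y\le C\|x\|_X$ for some constant $C$ and all $x\in X$. *)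

theory Defs
  imports "HOL-Analysis.Analysis"
begin

text \<open>Points of \<open>\<complex>\<^sup>2\<close> are pairs of complex numbers. A function is holomorphic on a domain if at each
  of its points the (real) Frechet derivative exists and is complex linear.\<close>

definition holomorphic2_on :: "(complex \<times> complex \<Rightarrow> complex) \<Rightarrow> (complex \<times> complex) set \<Rightarrow> bool"
  where "holomorphic2_on f \<Omega> \<longleftrightarrow>
    (\<forall>z\<in>\<Omega>. \<exists>a b. (f has_derivative (\<lambda>h. a * fst h + b * snd h)) (at z))"

text \<open>Elements of \<open>Lp_space\<close> are representatives, not classes modulo null sets; their values outside
  \<open>\<Omega>\<close> are irrelevant.\<close>

definition Lp_space :: "real \<Rightarrow> 'a::euclidean_space set \<Rightarrow> ('a \<Rightarrow> complex) set"
  where "Lp_space p \<Omega> = {f. f \<in> borel_measurable (lebesgue_on \<Omega>) \<and>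
    integrable (lebesgue_on \<Omega>) (\<lambda>z. norm (f z) powr p)}"

definition Lp_norm :: "real \<Rightarrow> 'a::euclidean_space set \<Rightarrow> ('a \<Rightarrow> complex) \<Rightarrow> real"
  where "Lp_norm p \<Omega> f = (integral\<^sup>L (lebesgue_on \<Omega>) (\<lambda>z. norm (f z) powr p)) powr (1 / p)"

definition L2_inner :: "'a::euclidean_space set \<Rightarrow> ('a \<Rightarrow> complex) \<Rightarrow> ('a \<Rightarrow> complex) \<Rightarrow> complex"
  where "L2_inner \<Omega> f g = integral\<^sup>L (lebesgue_on \<Omega>) (\<lambda>z. f z * cnj (g z))"

text \<open>A function on \<open>\<Omega>\<close> is encoded by its extension by zero, so that for open \<open>\<Omega>\<close> an element of
  \<open>bergman_space\<close> is determined by its class in \<open>L\<^sup>p(\<Omega>)\<close>.\<close>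

definition bergman_space :: "real \<Rightarrow> (complex \<times> complex) set \<Rightarrow> (complex \<times> complex \<Rightarrow> complex) set"
  where "bergman_space p \<Omega> =
    {f \<in> Lp_space p \<Omega>. holomorphic2_on f \<Omega> \<and> (\<forall>z. z \<notin> \<Omega> \<longrightarrow> f z = 0)}"

text \<open>The orthogonal projection of \<open>f \<in> L\<^sup>2(\<Omega>)\<close> is the element \<open>h\<close> of \<open>A\<^sup>2(\<Omega>)\<close> with
  \<open>f - h\<close> orthogonal to \<open>A\<^sup>2(\<Omega>)\<close>.\<close>

definition bergman_projection ::
    "(complex \<times> complex) set \<Rightarrow> (complex \<times> complex \<Rightarrow> complex) \<Rightarrow> (complex \<times> complex \<Rightarrow> complex)"
  where "bergman_projection \<Omega> f =
    (THE h. h \<in> bergman_space 2 \<Omega> \<and> (\<forall>g\<in>bergman_space 2 \<Omega>. L2_inner \<Omega> (\<lambda>z. f z - h z) g = 0))"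

definition friedrichs_operator ::
    "(complex \<times> complex) set \<Rightarrow> (complex \<times> complex \<Rightarrow> complex) \<Rightarrow> (complex \<times> complex \<Rightarrow> complex)"
  where "friedrichs_operator \<Omega> g = bergman_projection \<Omega> (\<lambda>z. cnj (g z))"

definition bounded_operator ::
    "'a set \<Rightarrow> ('a \<Rightarrow> real) \<Rightarrow> 'b set \<Rightarrow> ('b \<Rightarrow> real) \<Rightarrow> ('a \<Rightarrow> 'b) \<Rightarrow> bool"
  where "bounded_operator X norm_X Y norm_Y T \<longleftrightarrow>
    T ` X \<subseteq> Y \<and> (\<exists>C. \<forall>x\<in>X. norm_Y (T x) \<le> C * norm_X x)"

definition hartogs_triangle :: "(complex \<times> complex) set"
  where "hartogs_triangle = {(z1, z2). norm z1 < norm z2 \<and> norm z2 < 1}"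

end

theory Submission
  imports Defs "HOL-Complex_Analysis.Conformal_Mappings"
begin

text \<open>
  Integration over the Hartogs triangle \<open>H\<close> sees only the trace of a holomorphic function on the axis
  \<open>z\<^sub>1 = 0\<close>. For fixed \<open>z\<^sub>2 = w\<close> the slice is the disc of radius \<open>norm w\<close>, and the mean value property
  replaces the integral over it by \<open>pi * (norm w)\<^sup>2\<close> times the value at its centre; rotation
  invariance of the remaining integral in \<open>w\<close> then replaces the trace by its circular mean, a Laurent
  coefficient (\<open>hartogs_integral_average\<close>).

  If \<open>f\<close> is in \<open>A\<^sup>2(H)\<close>, then \<open>w * f (0, w)\<close> is square integrable on the punctured disc, and a
  square-integrable isolated singularity is removable (\<open>bergman_space_axis_extension\<close>). Thus
  \<open>f (0, w)\<close> has Laurent exponents \<open>-1, 0, 1, \<dots>\<close> only. For \<open>f\<close> and \<open>g\<close> in \<open>A\<^sup>2(H)\<close> the integral of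
  \<open>f g\<close> is a constant times the Laurent coefficient of \<open>f (0, w) * g (0, w)\<close> at exponent \<open>0\<close>, and so
  it involves only the exponents \<open>-1, 0, 1\<close> of either factor (\<open>integral_bergman_mult\<close>). This integral
  is the inner product of \<open>f\<close> with the conjugate of \<open>g\<close>; hence the projection of the conjugate of
  \<open>g\<close> is a combination of \<open>1/z\<^sub>2\<close>, \<open>1\<close> and \<open>z\<^sub>2\<close> with coefficients that depend boundedly on \<open>g\<close>
  (\<open>friedrichs_operator_eq\<close>, \<open>norm_axis_coeff_le\<close>). All three functions are dominated by \<open>1/z\<^sub>2\<close>,
  and the integral of \<open>norm (1/z\<^sub>2) powr p\<close> over \<open>H\<close> equals that of \<open>pi * norm w powr (2 - p)\<close> over
  the unit disc, which is finite for \<open>p < 4\<close>.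

  The Bergman projection, by contrast, fixes every element of \<open>A\<^sup>2(H)\<close>, and the function
  \<open>(1 - z\<^sub>2) powr (- 2 / p)\<close> lies in \<open>A\<^sup>2(H)\<close> but not in \<open>A\<^sup>p(H)\<close> when \<open>p > 2\<close>
  (\<open>bergman_space_2_not_subset\<close>).
\<close>

section \<open>Rotation averages in the plane\<close>

unbundle no fps_syntax

text \<open>Identifies the plane with \<open>real^2\<close>, where orthogonal maps preserve Lebesgue measure; rotation
  invariance is transported along this map.\<close>

lemma lborel_distr_cart2: "distr lborel borel (\<lambda>v::real^2. Complex (v$1) (v$2)) = lborel"
proof -
  have meas: "(\<lambda>v::real^2. Complex (v$1) (v$2)) \<in> borel_measurable borel"
    by (intro borel_measurable_continuous_onI continuous_intros)
  have "lborel = distr lborel borel (\<lambda>v::real^2. Complex (v$1) (v$2))"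
  proof (rule lborel_eqI)
    fix l u :: complex assume *: "\<And>b. b \<in> Basis \<Longrightarrow> l \<bullet> b \<le> u \<bullet> b"
    have le: "Re l \<le> Re u" "Im l \<le> Im u" using *[of 1] *[of "\<i>"] by (auto simp: Basis_complex_def inner_complex_def)
    have "(\<lambda>v::real^2. Complex (v$1) (v$2)) -` box l u = box (vector [Re l, Im l]) (vector [Re u, Im u])"
      by (auto simp: mem_box_cart forall_2 mem_box Basis_complex_def inner_complex_def)
    then show "emeasure (distr lborel borel (\<lambda>v::real^2. Complex (v$1) (v$2))) (box l u) = (\<Prod>b\<in>Basis. (u - l) \<bullet> b)"
      using le meas
      by (simp add: emeasure_distr, subst emeasure_lborel_box)
         (auto simp: Basis_vec_def Basis_complex_def inner_complex_def inner_axis UNIV_2 forall_2 axis_eq_axis)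
  qed simp
  then show ?thesis by simp
qed

lemma lborel_distr_rotation:
  fixes c :: complex
  assumes c: "norm c = 1"
  shows "distr lborel borel (\<lambda>z. c * z) = lborel"
proof -
  define k where "k = (\<lambda>v::real^2. Complex (v$1) (v$2))"
  define R where "R = (\<lambda>v::real^2. (vector [Re (cnj c * k v), Im (cnj c * k v)] :: real^2))"
  have kR: "k (R v) = cnj c * k v" for v by (simp add: k_def R_def complex_eq_iff)
  have injk: "k v = k w \<longleftrightarrow> v = w" for v w by (auto simp: k_def vec_eq_iff forall_2)
  have meas [measurable]: "k \<in> borel_measurable borel"
    unfolding k_def by (intro borel_measurable_continuous_onI continuous_intros)
  have cc: "c * cnj c = 1" using c complex_norm_square[of c] by simp
  have normk: "norm (k v) = norm v" for v
    by (simp add: k_def norm_vec_def L2_set_def UNIV_2 cmod_def)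
  have lin: "linear R"
    by (auto intro!: linearI simp: R_def k_def vec_eq_iff forall_2 algebra_simps)
  have orth: "orthogonal_transformation R"
    using lin unfolding orthogonal_transformation
    by (metis normk kR c norm_mult complex_mod_cnj mult_1)
  have dist: "distr lborel borel k = (lborel :: complex measure)"
    using lborel_distr_cart2 by (simp add: k_def)
  have "lborel = distr lborel borel (\<lambda>z. c * z)"
  proof (rule lborel_eqI)
    fix l u :: complex assume *: "\<And>b. b \<in> Basis \<Longrightarrow> l \<bullet> b \<le> u \<bullet> b"
    let ?B = "box l u"
    let ?S = "k -` ?B"
    have S: "?S \<in> sets borel" using measurable_sets[OF meas, of ?B] by simp
    have eS: "emeasure lborel ?S = emeasure lborel ?B"
      by (subst dist[symmetric]) (simp add: emeasure_distr)
    have lm: "?S \<in> lmeasurable"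
      using eS S emeasure_bounded_finite[OF bounded_box[of l u]] by (intro fmeasurableI) auto
    have img: "k -` ((\<lambda>z. c * z) -` ?B) = R ` ?S" (is "?L = _")
    proof (intro set_eqI iffI)
      fix v assume "v \<in> ?L"
      then have "c * k v \<in> ?B" by simp
      define w where "w = (vector [Re (c * k v), Im (c * k v)] :: real^2)"
      have kw: "k w = c * k v" by (simp add: k_def w_def complex_eq_iff)
      then have "k (R w) = k v" using cc by (simp add: kR mult.assoc[symmetric] mult.commute)
      then have "R w = v" by (simp add: injk)
      moreover have "w \<in> ?S" using kw \<open>c * k v \<in> ?B\<close> by simp
      ultimately show "v \<in> R ` ?S" by blast
    next
      fix v assume "v \<in> R ` ?S"
      then obtain w where w: "k w \<in> ?B" "v = R w" by auto
      then have "c * k v = k w" using cc by (simp add: kR mult.assoc[symmetric])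
      then show "v \<in> ?L" using w by simp
    qed
    have L: "?L \<in> sets borel" 
      by (intro measurable_sets_borel[OF meas] measurable_sets_borel[where f="\<lambda>z. c*z"]) (auto intro!: borel_measurable_continuous_onI continuous_intros)
    have m: "measure lebesgue (R ` ?S) = measure lebesgue ?S" and Rm: "R ` ?S \<in> lmeasurable"
      using measure_orthogonal_image[OF orth lm] measurable_orthogonal_image[OF orth lm] by auto
    have "emeasure (distr lborel borel (\<lambda>z. c * z)) ?B = emeasure lborel ((\<lambda>z. c * z) -` ?B)"
      by (simp add: emeasure_distr)
    also have "\<dots> = emeasure (distr lborel borel k) ((\<lambda>z. c * z) -` ?B)" by (simp add: dist)
    also have "\<dots> = emeasure lborel ?L"
      by (subst emeasure_distr) (auto intro!: measurable_sets_borel[where f="\<lambda>z. c*z"] borel_measurable_continuous_onI continuous_intros)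
    also have "\<dots> = emeasure lebesgue (R ` ?S)" unfolding img[symmetric] using L by (simp add: emeasure_completion)
    also have "\<dots> = emeasure lebesgue ?S"
      using m Rm lm by (simp add: emeasure_eq_measure2)
    also have "\<dots> = emeasure lborel ?B" using S eS by simp
    also have "\<dots> = (\<Prod>b\<in>Basis. (u - l) \<bullet> b)" using * by (simp add: emeasure_lborel_box)
    finally show "emeasure (distr lborel borel (\<lambda>z. c * z)) ?B = (\<Prod>b\<in>Basis. (u - l) \<bullet> b)" .
  qed simp
  then show ?thesis by simp
qed

text \<open>The unit circle is parametrised by the unit interval, so that a circular mean is an integral over
  \<open>{0..1}\<close> without a normalising factor.\<close>

definition rot :: "real \<Rightarrow> complex" where "rot t = exp (2 * of_real pi * \<i> * of_real t)"

lemma norm_rot [simp]: "norm (rot t) = 1"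
  by (simp add: rot_def)
lemma rot_nonzero [simp]: "rot t \<noteq> 0" by (simp add: rot_def)
lemma continuous_on_rot [continuous_intros]: "continuous_on A rot"
  unfolding rot_def by (intro continuous_intros)
lemma borel_measurable_rot [measurable]: "rot \<in> borel_measurable borel"
  by (intro borel_measurable_continuous_onI continuous_intros)

text \<open>A replacement for polar coordinates: each rotated copy of the integrand has the same integral, and
  averaging over the angle commutes with integration by Tonelli's theorem.\<close>

lemma nn_integral_rotation_average:
  fixes f :: "complex \<Rightarrow> ennreal"
  assumes [measurable]: "f \<in> borel_measurable borel"
  shows "(\<integral>\<^sup>+z. f z \<partial>lborel) = (\<integral>\<^sup>+z. (\<integral>\<^sup>+t. f (rot t * z) * indicator {0..1} t \<partial>lborel) \<partial>lborel)"
proof -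
  have "(\<integral>\<^sup>+z. (\<integral>\<^sup>+t. f (rot t * z) * indicator {0..1} t \<partial>lborel) \<partial>lborel)
      = (\<integral>\<^sup>+t. (\<integral>\<^sup>+z. f (rot t * z) * indicator {0..1} t \<partial>lborel) \<partial>lborel)"
    by (rule lborel_pair.Fubini') measurable
  also have "\<dots> = (\<integral>\<^sup>+t. (\<integral>\<^sup>+z. f z \<partial>lborel) * indicator {0..1::real} t \<partial>lborel)"
  proof (rule nn_integral_cong)
    fix t :: real
    have "(\<integral>\<^sup>+z. f z \<partial>lborel) = (\<integral>\<^sup>+z. f z \<partial>distr lborel borel (\<lambda>z. rot t * z))"
      by (simp add: lborel_distr_rotation)
    also have "\<dots> = (\<integral>\<^sup>+z. f (rot t * z) \<partial>lborel)"
      by (subst nn_integral_distr) auto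
    finally show "(\<integral>\<^sup>+z. f (rot t * z) * indicator {0..1} t \<partial>lborel) = (\<integral>\<^sup>+z. f z \<partial>lborel) * indicator {0..1} t"
      by (simp add: nn_integral_multc)
  qed
  also have "\<dots> = (\<integral>\<^sup>+z. f z \<partial>lborel)"
    by (simp add: nn_integral_cmult_indicator)
  finally show ?thesis by simp
qed

lemma integral_rotation_average:
  fixes f :: "complex \<Rightarrow> complex"
  assumes int: "integrable lborel f"
  shows "(LINT z|lborel. f z) = (LINT z|lborel. (LINT t:{0..1}|lborel. f (rot t * z)))"
proof -
  have [measurable]: "f \<in> borel_measurable borel" using int by auto
  have nn: "(\<integral>\<^sup>+z. (\<integral>\<^sup>+t. ennreal (norm (f (rot t * z))) * indicator {0..1} t \<partial>lborel) \<partial>lborel) < \<infinity>"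
    using int nn_integral_rotation_average[of "\<lambda>z. ennreal (norm (f z))"]
    by (simp add: integrable_iff_bounded)
  have "integrable (lborel \<Otimes>\<^sub>M lborel) (\<lambda>(z,t). indicator {0..1} t *\<^sub>R f (rot t * z))"
    unfolding integrable_iff_bounded
  proof
    have "(\<integral>\<^sup>+x. ennreal (norm (case x of (z, t) \<Rightarrow> indicator {0..1} t *\<^sub>R f (rot t * z))) \<partial>(lborel \<Otimes>\<^sub>M lborel))
       = (\<integral>\<^sup>+z. (\<integral>\<^sup>+t. ennreal (norm (indicator {0..1::real} t *\<^sub>R f (rot t * z))) \<partial>lborel) \<partial>lborel)"
      by (subst lborel.nn_integral_fst[symmetric]) auto
    also have "\<dots> = (\<integral>\<^sup>+z. (\<integral>\<^sup>+t. ennreal (norm (f (rot t * z))) * indicator {0..1} t \<partial>lborel) \<partial>lborel)"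
      by (intro nn_integral_cong) (auto split: split_indicator)
    finally show "(\<integral>\<^sup>+x. ennreal (norm (case x of (z, t) \<Rightarrow> indicator {0..1::real} t *\<^sub>R f (rot t * z))) \<partial>(lborel \<Otimes>\<^sub>M lborel)) < \<infinity>"
      using nn by simp
  qed auto
  then have "(LINT z|lborel. (LINT t|lborel. indicator {0..1} t *\<^sub>R f (rot t * z)))
     = (LINT t|lborel. (LINT z|lborel. indicator {0..1::real} t *\<^sub>R f (rot t * z)))"
    by (rule lborel_pair.Fubini_integral[symmetric])
  also have "\<dots> = (LINT t|lborel. indicator {0..1::real} t *\<^sub>R (LINT z|lborel. f z))"
  proof (rule Bochner_Integration.integral_cong)
    fix t :: real
    have "(LINT z|lborel. f z) = (LINT z|distr lborel borel (\<lambda>z. rot t * z). f z)"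
      by (simp add: lborel_distr_rotation)
    also have "\<dots> = (LINT z|lborel. f (rot t * z))"
      by (subst integral_distr) auto
    finally show "(LINT z|lborel. indicator {0..1} t *\<^sub>R f (rot t * z)) = indicator {0..1} t *\<^sub>R (LINT z|lborel. f z)"
      by simp
  qed simp
  also have "\<dots> = (LINT z|lborel. f z)" by simp
  finally show ?thesis by (simp add: set_lebesgue_integral_def)
qed

lemma circle_mean_real:
  assumes r: "r > 0" and cont: "continuous_on (sphere 0 r) f" 
  shows "(LINT t:{0..1}|lborel. f (rot t * of_real r)) = contour_integral (circlepath 0 r) (\<lambda>w. f w / w) / (2 * of_real pi * \<i>)"
proof -
  have c: "continuous_on {0..1} (\<lambda>t. f (rot t * of_real r))"
    by (rule continuous_on_compose2[OF cont]) (use r in \<open>auto intro!: continuous_intros simp: norm_mult\<close>)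
  have i: "set_integrable lborel {0..1} (\<lambda>t. f (rot t * of_real r))"
    by (rule borel_integrable_atLeastAtMost') (rule c)
  have "(LINT t:{0..1}|lborel. f (rot t * of_real r)) = integral {0..1} (\<lambda>t. f (rot t * of_real r))"
    by (rule set_borel_integral_eq_integral(2)[OF i])
  moreover have "contour_integral (circlepath 0 r) (\<lambda>w. f w / w) = integral {0..1} (\<lambda>t. (2 * of_real pi * \<i>) * f (rot t * of_real r))"
    unfolding contour_integral_integral
  proof (rule Henstock_Kurzweil_Integration.integral_cong)
    fix t :: real assume "t \<in> {0..1}"
    have "circlepath 0 r t = rot t * of_real r" by (simp add: circlepath rot_def)
    moreover have "vector_derivative (circlepath 0 r) (at t) = 2 * of_real pi * \<i> * (rot t * of_real r)"
      by (simp add: vector_derivative_circlepath rot_def)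
    ultimately show "f (circlepath 0 r t) / circlepath 0 r t * vector_derivative (circlepath 0 r) (at t)
         = (2 * of_real pi * \<i>) * f (rot t * of_real r)"
      using r by simp
  qed
  ultimately show "(LINT t:{0..1}|lborel. f (rot t * of_real r)) = contour_integral (circlepath 0 r) (\<lambda>w. f w / w) / (2 * of_real pi * \<i>)"
    by simp
qed

text \<open>Cauchy's formula for the derivatives on the circle through \<open>z\<close>. The starting point of the
  parametrisation is moved to the positive real axis by composing \<open>f\<close> with a rotation.\<close>

lemma circle_mean_Taylor_coeff:
  assumes hol: "f holomorphic_on ball 0 R" and z: "norm z < R" "z \<noteq> 0"
  shows "(LINT t:{0..1}|lborel. f (rot t * z) / (rot t * z) ^ k) = (deriv ^^ k) f 0 / fact k"
proof -
  define r where "r = norm z"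
  define s where "s = sgn z"
  define g where "g = (\<lambda>w. f (s * w))"
  have r: "0 < r" "r < R" and s: "norm s = 1" "s \<noteq> 0" "z = s * of_real r"
    using z by (auto simp: r_def s_def sgn_eq norm_divide)
  have holg: "g holomorphic_on ball 0 R"
    unfolding g_def using s by (intro holomorphic_on_compose_gen[OF _ hol, unfolded o_def] holomorphic_intros) (auto simp: norm_mult)
  have contg: "continuous_on (cball 0 r) g"
    using r by (intro holomorphic_on_imp_continuous_on holomorphic_on_subset[OF holg]) auto
  have dg: "(deriv ^^ k) g 0 = s ^ k * (deriv ^^ k) f 0"
    using higher_deriv_compose_linear[OF hol, of "ball 0 R" 0 s k] r s
    by (auto simp: g_def norm_mult)
  have "(LINT t:{0..1}|lborel. f (rot t * z) / (rot t * z) ^ k)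
     = (LINT t:{0..1}|lborel. (\<lambda>w. g w / (s ^ k * w ^ k)) (rot t * of_real r))"
    by (simp add: g_def s(3) mult_ac power_mult_distrib)
  also have "\<dots> = contour_integral (circlepath 0 r) (\<lambda>w. (g w / (s ^ k * w ^ k)) / w) / (2 * of_real pi * \<i>)"
    by (rule circle_mean_real) (use r s in \<open>auto intro!: continuous_intros continuous_on_subset[OF contg]\<close>)
  also have "(\<lambda>w. (g w / (s ^ k * w ^ k)) / w) = (\<lambda>w. (1 / s ^ k) * (g w / (w - 0) ^ Suc k))"
    by (auto simp: fun_eq_iff field_simps)
  also have "contour_integral (circlepath 0 r) \<dots> = (1 / s ^ k) * contour_integral (circlepath 0 r) (\<lambda>w. g w / (w - 0) ^ Suc k)"
    unfolding contour_integral_integral by (simp add: mult.assoc flip: integral_mult_right)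
  also have "contour_integral (circlepath 0 r) (\<lambda>w. g w / (w - 0) ^ Suc k) = (2 * pi * \<i>) * (deriv ^^ k) g 0 / fact k"
    by (rule Cauchy_contour_integral_circlepath) (use contg r holg in \<open>auto intro: holomorphic_on_subset\<close>)
  finally show ?thesis using s by (simp add: dg)
qed

lemma circle_mean_holomorphic:
  assumes hol: "f holomorphic_on ball 0 R" and z: "norm z < R"
  shows "(LINT t:{0..1}|lborel. f (rot t * z)) = f 0"
  using circle_mean_Taylor_coeff[OF hol z, of 0] by (cases "z = 0") (auto simp: set_lebesgue_integral_def)

lemma norm_center_le_circle_mean:
  assumes hol: "f holomorphic_on ball 0 R" and z: "norm z < R"
  shows "ennreal (norm (f 0)) \<le> (\<integral>\<^sup>+t. ennreal (norm (f (rot t * z))) * indicator {0..1} t \<partial>lborel)"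
proof -
  have c: "continuous_on {0..1} (\<lambda>t. f (rot t * z))"
    by (rule continuous_on_compose2[OF holomorphic_on_imp_continuous_on[OF hol]]) (use z in \<open>auto intro!: continuous_intros simp: norm_mult\<close>)
  have "set_integrable lborel {0..1} (\<lambda>t. f (rot t * z))"
    by (rule borel_integrable_atLeastAtMost') (rule c)
  then have "ennreal (norm (LINT t:{0..1}|lborel. f (rot t * z))) \<le> (\<integral>\<^sup>+t. ennreal (norm (indicator {0..1} t *\<^sub>R f (rot t * z))) \<partial>lborel)"
    unfolding set_integrable_def set_lebesgue_integral_def by (rule integral_norm_bound_ennreal)
  also have "\<dots> = (\<integral>\<^sup>+t. ennreal (norm (f (rot t * z))) * indicator {0..1} t \<partial>lborel)"
    by (intro nn_integral_cong) (auto split: split_indicator)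
  finally show ?thesis by (simp add: circle_mean_holomorphic[OF hol z])
qed

lemma emeasure_disc: "r \<ge> 0 \<Longrightarrow> emeasure lborel (ball (c::complex) r) = ennreal (pi * r\<^sup>2)"
  by (simp add: emeasure_ball unit_ball_vol_2)

lemma disc_mean_value:
  assumes hol: "f holomorphic_on ball 0 r" and int: "set_integrable lborel (ball 0 r) f" and r: "r \<ge> 0"
  shows "(LINT z:ball 0 r|lborel. f z) = of_real (pi * r\<^sup>2) * f 0"
proof -
  have "(LINT z:ball 0 r|lborel. f z) = (LINT z|lborel. (LINT t:{0..1}|lborel. indicator (ball 0 r) (rot t * z) *\<^sub>R f (rot t * z)))"
    using int unfolding set_integrable_def set_lebesgue_integral_def[of _ "ball 0 r"] by (rule integral_rotation_average)
  also have "\<dots> = (LINT z|lborel. indicator (ball (0::complex) r) z *\<^sub>R f 0)"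
  proof (rule Bochner_Integration.integral_cong)
    fix z
    show "(LINT t:{0..1}|lborel. indicator (ball 0 r) (rot t * z) *\<^sub>R f (rot t * z)) = indicator (ball 0 r) z *\<^sub>R f 0"
      using circle_mean_holomorphic[OF hol, of z]
      by (cases "z \<in> ball 0 r") (auto simp: norm_mult indicator_def set_lebesgue_integral_def)
  qed simp
  also have "\<dots> = of_real (pi * r\<^sup>2) * f 0"
    using r emeasure_disc[of r 0] by (simp add: measure_def scaleR_conv_of_real)
  finally show ?thesis .
qed

text \<open>Absolute values turn the circular mean value property into an inequality, which integrates by
  Tonelli's theorem; the right-hand side may be infinite.\<close>

lemma disc_sub_mean_value:
  assumes hol: "f holomorphic_on ball c r" and r: "r \<ge> 0"
  shows "ennreal (pi * r\<^sup>2 * norm (f c)) \<le> (\<integral>\<^sup>+z. ennreal (norm (f z)) * indicator (ball c r) z \<partial>lborel)"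
proof -
  define g where "g = (\<lambda>z. f (c + z))"
  have holg: "g holomorphic_on ball 0 r"
    unfolding g_def by (intro holomorphic_on_compose_gen[OF _ hol, unfolded o_def] holomorphic_intros) (auto simp: dist_norm)
  have m: "(\<lambda>z. indicator (ball 0 r) z *\<^sub>R g z) \<in> borel_measurable borel"
    by (intro borel_measurable_continuous_on_indicator holomorphic_on_imp_continuous_on[OF holg]) auto
  have eq: "ennreal (norm (indicator (ball 0 r) z *\<^sub>R g z)) = ennreal (norm (g z)) * indicator (ball 0 r) z" for z
    by (auto split: split_indicator)
  have mm [measurable]: "(\<lambda>z. ennreal (norm (g z)) * indicator (ball 0 r) z) \<in> borel_measurable borel"
    unfolding eq[symmetric] using m by measurable
  have mf: "(\<lambda>z. indicator (ball c r) z *\<^sub>R f z) \<in> borel_measurable borel"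
    by (intro borel_measurable_continuous_on_indicator holomorphic_on_imp_continuous_on[OF hol]) auto
  have eqf: "ennreal (norm (indicator (ball c r) z *\<^sub>R f z)) = ennreal (norm (f z)) * indicator (ball c r) z" for z
    by (auto split: split_indicator)
  have mmf [measurable]: "(\<lambda>z. ennreal (norm (f z)) * indicator (ball c r) z) \<in> borel_measurable borel"
    unfolding eqf[symmetric] using mf by measurable
  have "ennreal (pi * r\<^sup>2 * norm (f c)) = (\<integral>\<^sup>+z. ennreal (norm (g 0)) * indicator (ball (0::complex) r) z \<partial>lborel)"
    using r by (simp add: nn_integral_cmult_indicator emeasure_disc g_def ennreal_mult' mult.commute)
  also have "\<dots> \<le> (\<integral>\<^sup>+z. (\<integral>\<^sup>+t. (ennreal (norm (g (rot t * z))) * indicator (ball 0 r) (rot t * z)) * indicator {0..1} t \<partial>lborel) \<partial>lborel)"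
  proof (rule nn_integral_mono)
    fix z
    show "ennreal (norm (g 0)) * indicator (ball 0 r) z \<le> (\<integral>\<^sup>+t. (ennreal (norm (g (rot t * z))) * indicator (ball 0 r) (rot t * z)) * indicator {0..1} t \<partial>lborel)"
      using norm_center_le_circle_mean[OF holg, of z]
      by (cases "z \<in> ball 0 r") (auto simp: norm_mult indicator_def)
  qed
  also have "\<dots> = (\<integral>\<^sup>+z. ennreal (norm (g z)) * indicator (ball 0 r) z \<partial>lborel)"
    by (rule nn_integral_rotation_average[symmetric]) (rule mm)
  also have "\<dots> = (\<integral>\<^sup>+z. ennreal (norm (f (c + z))) * indicator (ball c r) (c + z) \<partial>lborel)"
    by (intro nn_integral_cong) (auto simp: g_def dist_norm split: split_indicator)
  also have "\<dots> = (\<integral>\<^sup>+z. ennreal (norm (f z)) * indicator (ball c r) z \<partial>distr lborel borel ((+) c))"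
    by (subst nn_integral_distr) auto
  also have "\<dots> = (\<integral>\<^sup>+z. ennreal (norm (f z)) * indicator (ball c r) z \<partial>lborel)"
    by (simp add: lborel_distr_plus)
  finally show ?thesis .
qed

section \<open>Square-integrable isolated singularities\<close>

text \<open>The sub-mean value property on the disc of centre \<open>w\<close> and radius \<open>norm w / 2\<close> bounds
  \<open>(norm (w * u w))\<^sup>2\<close> by a constant times the \<open>L\<^sup>2\<close> mass of \<open>u\<close> near \<open>0\<close>. This mass tends to \<open>0\<close> on
  shrinking discs, and so \<open>w * u w\<close> tends to \<open>0\<close>, which is Riemann's criterion.\<close>

lemma square_integrable_removable_singularity:
  assumes hol: "u holomorphic_on ball 0 1 - {0}"
    and fin: "(\<integral>\<^sup>+w. ennreal ((norm (u w))\<^sup>2) * indicator (ball 0 1 - {0}) w \<partial>lborel) < \<infinity>"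
  obtains v where "v holomorphic_on ball 0 1" "\<And>w. w \<in> ball 0 1 - {0} \<Longrightarrow> v w = u w"
proof -
  let ?D = "ball 0 1 - {0::complex}"
  have "(\<lambda>w. indicator ?D w *\<^sub>R (u w)\<^sup>2) \<in> borel_measurable borel"
    by (intro borel_measurable_continuous_on_indicator continuous_intros holomorphic_on_imp_continuous_on[OF hol]) auto
  then have "(\<lambda>w. ennreal (norm (indicator ?D w *\<^sub>R (u w)\<^sup>2))) \<in> borel_measurable borel"
    by measurable
  also have "(\<lambda>w. ennreal (norm (indicator ?D w *\<^sub>R (u w)\<^sup>2))) = (\<lambda>w. ennreal ((norm (u w))\<^sup>2) * indicator ?D w)"
    by (auto simp: fun_eq_iff norm_power split: split_indicator)
  finally have m [measurable]: "(\<lambda>w. ennreal ((norm (u w))\<^sup>2) * indicator ?D w) \<in> borel_measurable borel" .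
  \<comment> \<open>The mass on shrinking discs tends to \<open>0\<close> by continuity from above of this measure.\<close>
  define \<nu> where "\<nu> = density lborel (\<lambda>w. ennreal ((norm (u w))\<^sup>2) * indicator ?D w)"
  define B where "B = (\<lambda>n::nat. ball (0::complex) (1 / Suc n))"
  have sets_\<nu>: "sets \<nu> = sets borel" by (simp add: \<nu>_def)
  have em: "emeasure \<nu> A = (\<integral>\<^sup>+w. (ennreal ((norm (u w))\<^sup>2) * indicator ?D w) * indicator A w \<partial>lborel)" if "A \<in> sets borel" for A
    unfolding \<nu>_def using that by (subst emeasure_density) auto
  have emf: "emeasure \<nu> A \<noteq> \<infinity>" if "A \<in> sets borel" for A
  proof -
    have "emeasure \<nu> A \<le> (\<integral>\<^sup>+w. (ennreal ((norm (u w))\<^sup>2) * indicator ?D w) \<partial>lborel)"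
      unfolding em[OF that] by (intro nn_integral_mono) (auto split: split_indicator)
    then show ?thesis using fin by auto
  qed
  have "(\<lambda>n. emeasure \<nu> (B n)) \<longlonglongrightarrow> emeasure \<nu> (\<Inter>n. B n)"
    by (rule Lim_emeasure_decseq) (use emf in \<open>auto simp: sets_\<nu> B_def decseq_def frac_le intro!: subset_ball\<close>)
  also have "(\<Inter>n. B n) = {0}"
  proof (intro set_eqI iffI)
    fix x assume "x \<in> (\<Inter>n. B n)"
    then have *: "norm x < 1 / real (Suc n)" for n by (auto simp: B_def)
    show "x \<in> {0}"
    proof (rule ccontr)
      assume "x \<notin> {0}"
      then obtain n where "inverse (real (Suc n)) < norm x" using reals_Archimedean[of "norm x"] by auto
      with *[of n] show False by (simp add: inverse_eq_divide)
    qed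
  qed (auto simp: B_def)
  also have "emeasure \<nu> {0} = 0"
  proof -
    have "emeasure \<nu> {0} = (\<integral>\<^sup>+w. 0 \<partial>(lborel::complex measure))"
      unfolding em[OF borel_singleton[OF sets.empty_sets]] by (intro nn_integral_cong) (auto split: split_indicator)
    then show ?thesis by simp
  qed
  finally have lim: "(\<lambda>n. emeasure \<nu> (B n)) \<longlonglongrightarrow> 0" .
  have bound: "ennreal (pi / 4 * (norm (w * u w))\<^sup>2) \<le> emeasure \<nu> (B n)" if w: "w \<noteq> 0" "norm w < 1 / (2 * Suc n)" for w n
  proof -
    have sub: "ball w (norm w / 2) \<subseteq> ?D \<inter> B n"
    proof
      fix z assume z: "z \<in> ball w (norm w / 2)"
      then have "norm (w - z) < norm w / 2" by (simp add: dist_norm)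
      moreover have "norm z \<le> norm w + norm (w - z)" "norm w \<le> norm z + norm (w - z)"
        using norm_triangle_ineq4[of w "w - z"] norm_triangle_ineq[of z "w - z"] by auto
      moreover have "2 * norm w < 1 / Suc n" using w by (simp add: field_simps)
      moreover have "1 / Suc n \<le> (1::real)" by simp
      ultimately have "norm z < 1 / Suc n" "norm z < 1" "norm z > 0" by linarith+
      then show "z \<in> ?D \<inter> B n" by (simp add: B_def)
    qed
    have h2: "(\<lambda>z. (u z)\<^sup>2) holomorphic_on ball w (norm w / 2)"
      using sub by (intro holomorphic_intros holomorphic_on_subset[OF hol]) auto
    have "ennreal (pi / 4 * (norm (w * u w))\<^sup>2) = ennreal (pi * (norm w / 2)\<^sup>2 * norm ((u w)\<^sup>2))"
      by (simp add: norm_mult norm_power power_mult_distrib power_divide)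
    also have "\<dots> \<le> (\<integral>\<^sup>+z. ennreal (norm ((u z)\<^sup>2)) * indicator (ball w (norm w / 2)) z \<partial>lborel)"
      by (rule disc_sub_mean_value[OF h2]) simp
    also have "\<dots> \<le> emeasure \<nu> (B n)"
    proof (subst em)
      have "ennreal (norm ((u z)\<^sup>2)) * indicator (ball w (norm w / 2)) z \<le> ennreal ((norm (u z))\<^sup>2) * indicator ?D z * indicator (B n) z" for z
        using subsetD[OF sub, of z] by (cases "z \<in> ball w (norm w / 2)") (auto simp: norm_power)
      then show "(\<integral>\<^sup>+z. ennreal (norm ((u z)\<^sup>2)) * indicator (ball w (norm w / 2)) z \<partial>lborel)
        \<le> (\<integral>\<^sup>+z. ennreal ((norm (u z))\<^sup>2) * indicator ?D z * indicator (B n) z \<partial>lborel)"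
        by (intro nn_integral_mono)
    qed (simp add: B_def)
    finally show ?thesis .
  qed
  have "((\<lambda>w. (w - 0) * u w) \<longlongrightarrow> 0) (at 0)"
  proof (rule tendstoI)
    fix e :: real assume e: "e > 0"
    then have "0 < ennreal (pi / 4 * e\<^sup>2)" by simp
    from order_tendstoD(2)[OF lim this] obtain n where n: "emeasure \<nu> (B n) < ennreal (pi / 4 * e\<^sup>2)"
      by (auto simp: eventually_sequentially)
    have "dist ((w - 0) * u w) 0 < e" if w: "w \<noteq> 0" "norm w < 1 / (2 * Suc n)" for w
    proof -
      have "ennreal (pi / 4 * (norm (w * u w))\<^sup>2) < ennreal (pi / 4 * e\<^sup>2)"
        using bound[OF w] n by (rule le_less_trans)
      then have "(norm (w * u w))\<^sup>2 < e\<^sup>2" by (simp add: ennreal_less_iff)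
      then show ?thesis using e by (simp add: power_less_imp_less_base)
    qed
    then show "\<forall>\<^sub>F w in at 0. dist ((w - 0) * u w) 0 < e"
      unfolding eventually_at by (intro exI[of _ "1 / (2 * Suc n)"]) auto
  qed
  moreover have "0 \<in> interior (ball (0::complex) 1)" by simp
  ultimately obtain v where "v holomorphic_on ball 0 1" "\<forall>w \<in> ball 0 1 - {0}. v w = u w"
    using holomorphic_on_extend_lim[OF hol] by blast
  then show ?thesis using that by blast
qed

section \<open>Integration of continuous functions over open sets\<close>

text \<open>A function that is continuous on an open set has a Borel extension by zero, and so completing the
  Borel measure makes no difference; this gives access to Fubini's theorem, which is about product
  measures.\<close>

lemma
  fixes f :: "'a::euclidean_space \<Rightarrow> 'b::euclidean_space"
  assumes S: "open S" and f: "continuous_on S f"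
  shows integrable_lebesgue_on_continuous: "integrable (lebesgue_on S) f \<longleftrightarrow> set_integrable lborel S f"
    and integral_lebesgue_on_continuous: "integral\<^sup>L (lebesgue_on S) f = (LINT x:S|lborel. f x)"
    and measurable_lebesgue_on_continuous: "f \<in> borel_measurable (lebesgue_on S)"
proof -
  have m: "(\<lambda>x. indicator S x *\<^sub>R f x) \<in> borel_measurable borel"
    by (rule borel_measurable_continuous_on_indicator) (use S f in auto)
  show "integrable (lebesgue_on S) f \<longleftrightarrow> set_integrable lborel S f"
    using S m by (simp add: integrable_restrict_space set_integrable_def integrable_completion)
  show "integral\<^sup>L (lebesgue_on S) f = (LINT x:S|lborel. f x)"
    using S m by (simp add: integral_restrict_space set_lebesgue_integral_def integral_completion)
  have "(\<lambda>x. indicator S x *\<^sub>R f x) \<in> borel_measurable lebesgue"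
    using m by (simp add: measurable_completion)
  then show "f \<in> borel_measurable (lebesgue_on S)"
    using S by (subst borel_measurable_restrict_space_iff) (auto simp: mult.commute)
qed

lemma continuous_on_norm_powr:
  fixes f :: "'a::topological_space \<Rightarrow> complex"
  assumes "continuous_on S f" "p > (0::real)"
  shows "continuous_on S (\<lambda>x. norm (f x) powr p)"
  using assms by (intro continuous_on_powr' continuous_intros) auto

lemma Lp_space_continuous_iff:
  assumes S: "open S" and f: "continuous_on S f" and p: "p > 0"
  shows "f \<in> Lp_space p S \<longleftrightarrow> set_integrable lborel S (\<lambda>z. norm (f z) powr p)"
  using integrable_lebesgue_on_continuous[OF S continuous_on_norm_powr[OF f p]] measurable_lebesgue_on_continuous[OF S f]
  by (simp add: Lp_space_def)

lemma Lp_norm_continuous: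
  assumes S: "open S" and f: "continuous_on S f" and p: "p > 0"
  shows "Lp_norm p S f = (LINT z:S|lborel. norm (f z) powr p) powr (1 / p)"
  using integral_lebesgue_on_continuous[OF S continuous_on_norm_powr[OF f p]]
  by (simp add: Lp_norm_def)

lemma Lp_space_2_continuous_iff:
  assumes S: "open S" and f: "continuous_on S f"
  shows "f \<in> Lp_space 2 S \<longleftrightarrow> set_integrable lborel S (\<lambda>z. (norm (f z))\<^sup>2)"
  using Lp_space_continuous_iff[OF assms, of 2] by simp

lemma Lp_norm_2_continuous:
  assumes S: "open S" and f: "continuous_on S f"
  shows "(Lp_norm 2 S f)\<^sup>2 = (LINT z:S|lborel. (norm (f z))\<^sup>2)" "Lp_norm 2 S f \<ge> 0"
proof -
  have "0 \<le> (LINT z:S|lborel. (norm (f z))\<^sup>2)"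
    unfolding set_lebesgue_integral_def by (intro Bochner_Integration.integral_nonneg) auto
  then show "(Lp_norm 2 S f)\<^sup>2 = (LINT z:S|lborel. (norm (f z))\<^sup>2)" "Lp_norm 2 S f \<ge> 0"
    using Lp_norm_continuous[OF assms, of 2] by (auto simp: powr_half_sqrt)
qed

lemma set_borel_measurable_continuous_open:
  fixes f :: "'a::euclidean_space \<Rightarrow> 'b::real_normed_vector"
  assumes "open S" "continuous_on S f"
  shows "set_borel_measurable lborel S f"
  unfolding set_borel_measurable_def using borel_measurable_continuous_on_indicator[of S f] assms by auto

lemma set_integrable_mult_square_integrable:
  fixes f g :: "'a::euclidean_space \<Rightarrow> complex"
  assumes S: "open S" and f: "continuous_on S f" "set_integrable lborel S (\<lambda>z. (norm (f z))\<^sup>2)"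
    and g: "continuous_on S g" "set_integrable lborel S (\<lambda>z. (norm (g z))\<^sup>2)"
  shows "set_integrable lborel S (\<lambda>z. f z * g z)"
proof (rule set_integrable_bound)
  show "set_integrable lborel S (\<lambda>z. (norm (f z))\<^sup>2 + (norm (g z))\<^sup>2)"
    using f g by (intro set_integral_add) auto
  show "set_borel_measurable lborel S (\<lambda>z. f z * g z)"
    by (intro set_borel_measurable_continuous_open continuous_intros S f g)
  have "norm (f z * g z) \<le> norm ((norm (f z))\<^sup>2 + (norm (g z))\<^sup>2)" for z
  proof -
    have "2 * norm (f z) * norm (g z) \<le> (norm (f z))\<^sup>2 + (norm (g z))\<^sup>2" by (rule sum_squares_bound)
    moreover have "0 \<le> norm (f z) * norm (g z)" by simp
    ultimately have "norm (f z) * norm (g z) \<le> (norm (f z))\<^sup>2 + (norm (g z))\<^sup>2" by linarith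
    then show ?thesis by (simp add: norm_mult)
  qed
  then show "AE z in lborel. z \<in> S \<longrightarrow> norm (f z * g z) \<le> norm ((norm (f z))\<^sup>2 + (norm (g z))\<^sup>2)" by simp
qed

text \<open>The integrand is a plain product: conjugation preserves the norm, so that the version for the inner
  product follows by conjugating one factor.\<close>

lemma Cauchy_Schwarz_L2:
  fixes f g :: "'a::euclidean_space \<Rightarrow> complex"
  assumes S: "open S" and f: "continuous_on S f" "f \<in> Lp_space 2 S"
    and g: "continuous_on S g" "g \<in> Lp_space 2 S"
  shows "norm (LINT z:S|lborel. f z * g z) \<le> Lp_norm 2 S f * Lp_norm 2 S g"
proof -
  have f2: "set_integrable lborel S (\<lambda>z. (norm (f z))\<^sup>2)" and g2: "set_integrable lborel S (\<lambda>z. (norm (g z))\<^sup>2)"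
    using f g Lp_space_2_continuous_iff[OF S] by auto
  have mf: "(\<lambda>z. ennreal (norm (indicator S z *\<^sub>R f z))) \<in> borel_measurable lborel"
    and mg: "(\<lambda>z. ennreal (norm (indicator S z *\<^sub>R g z))) \<in> borel_measurable lborel"
    using set_borel_measurable_continuous_open[OF S f(1)] set_borel_measurable_continuous_open[OF S g(1)]
    unfolding set_borel_measurable_def by measurable
  have sq: "(\<integral>\<^sup>+z. (ennreal (norm (indicator S z *\<^sub>R h z)))\<^sup>2 \<partial>lborel) = ennreal ((Lp_norm 2 S h)\<^sup>2)"
    if h: "continuous_on S h" "set_integrable lborel S (\<lambda>z. (norm (h z))\<^sup>2)" for h :: "'a \<Rightarrow> complex"
  proof -
    have "(\<integral>\<^sup>+z. (ennreal (norm (indicator S z *\<^sub>R h z)))\<^sup>2 \<partial>lborel) = (\<integral>\<^sup>+z. ennreal (indicator S z *\<^sub>R (norm (h z))\<^sup>2) \<partial>lborel)"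
      by (intro nn_integral_cong) (auto simp: ennreal_power split: split_indicator)
    also have "\<dots> = ennreal (LINT z|lborel. indicator S z *\<^sub>R (norm (h z))\<^sup>2)"
      using h(2) unfolding set_integrable_def by (intro nn_integral_eq_integral) auto
    finally show ?thesis using Lp_norm_2_continuous(1)[OF S h(1)] by (simp add: set_lebesgue_integral_def)
  qed
  have int: "integrable lborel (\<lambda>z. indicator S z *\<^sub>R (f z * g z))"
    using set_integrable_mult_square_integrable[OF S f(1) f2 g(1) g2] by (simp add: set_integrable_def)
  have "ennreal (norm (LINT z:S|lborel. f z * g z)) \<le> (\<integral>\<^sup>+z. ennreal (norm (indicator S z *\<^sub>R (f z * g z))) \<partial>lborel)"
    unfolding set_lebesgue_integral_def by (rule integral_norm_bound_ennreal[OF int])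
  also have "\<dots> = (\<integral>\<^sup>+z. ennreal (norm (indicator S z *\<^sub>R f z)) * ennreal (norm (indicator S z *\<^sub>R g z)) \<partial>lborel)"
    by (intro nn_integral_cong) (auto simp: norm_mult ennreal_mult split: split_indicator)
  finally have "(ennreal (norm (LINT z:S|lborel. f z * g z)))\<^sup>2 \<le> (\<integral>\<^sup>+z. ennreal (norm (indicator S z *\<^sub>R f z)) * ennreal (norm (indicator S z *\<^sub>R g z)) \<partial>lborel)\<^sup>2"
    by (intro power_mono) auto
  also have "\<dots> \<le> ennreal ((Lp_norm 2 S f)\<^sup>2) * ennreal ((Lp_norm 2 S g)\<^sup>2)"
    using Cauchy_Schwarz_nn_integral[OF mf mg] unfolding sq[OF f(1) f2] sq[OF g(1) g2] .
  finally have "ennreal ((norm (LINT z:S|lborel. f z * g z))\<^sup>2) \<le> ennreal ((Lp_norm 2 S f * Lp_norm 2 S g)\<^sup>2)"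
    by (simp add: ennreal_power power_mult_distrib ennreal_mult)
  then have "(norm (LINT z:S|lborel. f z * g z))\<^sup>2 \<le> (Lp_norm 2 S f * Lp_norm 2 S g)\<^sup>2"
    by (subst (asm) ennreal_le_iff) auto
  then show ?thesis
    by (rule power2_le_imp_le) (simp add: Lp_norm_2_continuous(2)[OF S] f g)
qed

lemma Lp_norm_le:
  assumes S: "open S" and f: "continuous_on S f" "f \<in> Lp_space p S" and h: "continuous_on S h" "h \<in> Lp_space p S"
    and p: "p > 0" and K: "K \<ge> 0" "\<And>z. z \<in> S \<Longrightarrow> norm (f z) \<le> K * norm (h z)"
  shows "Lp_norm p S f \<le> K * Lp_norm p S h"
proof -
  have if': "set_integrable lborel S (\<lambda>z. norm (f z) powr p)" and ih: "set_integrable lborel S (\<lambda>z. norm (h z) powr p)"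
    using f h p Lp_space_continuous_iff[OF S] by auto
  have "(LINT z:S|lborel. norm (f z) powr p) \<le> (LINT z:S|lborel. K powr p * norm (h z) powr p)"
  proof (rule set_integral_mono[OF if'])
    show "set_integrable lborel S (\<lambda>z. K powr p * norm (h z) powr p)" using ih by simp
    fix z assume "z \<in> S"
    then have "norm (f z) powr p \<le> (K * norm (h z)) powr p" using K p by (intro powr_mono2) auto
    then show "norm (f z) powr p \<le> K powr p * norm (h z) powr p" using K by (simp add: powr_mult)
  qed
  also have "\<dots> = K powr p * (LINT z:S|lborel. norm (h z) powr p)" by simp
  finally have le: "(LINT z:S|lborel. norm (f z) powr p) \<le> K powr p * (LINT z:S|lborel. norm (h z) powr p)" .
  have n: "0 \<le> (LINT z:S|lborel. norm (k z) powr p)" for k :: "'a \<Rightarrow> complex"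
    unfolding set_lebesgue_integral_def by (intro Bochner_Integration.integral_nonneg) auto
  have "Lp_norm p S f \<le> (K powr p * (LINT z:S|lborel. norm (h z) powr p)) powr (1 / p)"
    unfolding Lp_norm_continuous[OF S f(1) p] using le n p by (intro powr_mono2) auto
  also have "\<dots> = K * Lp_norm p S h"
    unfolding Lp_norm_continuous[OF S h(1) p] using n K p by (simp add: powr_mult powr_powr)
  finally show ?thesis .
qed

lemma L2_inner_continuous:
  assumes "open S" "continuous_on S f" "continuous_on S g"
  shows "L2_inner S f g = (LINT z:S|lborel. f z * cnj (g z))"
  unfolding L2_inner_def by (rule integral_lebesgue_on_continuous) (use assms in \<open>auto intro!: continuous_intros\<close>)

lemma Lp_space_2_cnj:
  assumes "open S" "continuous_on S f" "f \<in> Lp_space 2 S"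
  shows "(\<lambda>z. cnj (f z)) \<in> Lp_space 2 S" "continuous_on S (\<lambda>z. cnj (f z))"
proof -
  show c: "continuous_on S (\<lambda>z. cnj (f z))" using assms by (intro continuous_intros)
  show "(\<lambda>z. cnj (f z)) \<in> Lp_space 2 S"
    using assms(3) unfolding Lp_space_2_continuous_iff[OF assms(1,2)] Lp_space_2_continuous_iff[OF assms(1) c] by simp
qed

text \<open>The set where \<open>d\<close> does not vanish is open and null. Elements of Bergman spaces are functions and not
  classes, so uniqueness of the projection rests on this.\<close>

lemma continuous_eq_0_if_L2_norm_0:
  fixes d :: "'a::euclidean_space \<Rightarrow> complex"
  assumes S: "open S" and d: "continuous_on S d" and int: "set_integrable lborel S (\<lambda>z. d z * cnj (d z))"
    and 0: "(LINT z:S|lborel. d z * cnj (d z)) = 0" and z: "z \<in> S"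
  shows "d z = 0"
proof -
  have eq: "indicator S z *\<^sub>R (d z * cnj (d z)) = of_real (indicator S z *\<^sub>R (norm (d z))\<^sup>2)" for z
    by (simp add: complex_norm_square[symmetric] scaleR_conv_of_real)
  have i: "integrable lborel (\<lambda>z. indicator S z *\<^sub>R (norm (d z))\<^sup>2)"
    using int unfolding set_integrable_def eq complex_of_real_integrable_eq .
  have "(LINT z|lborel. indicator S z *\<^sub>R (norm (d z))\<^sup>2) = 0"
    using 0 unfolding set_lebesgue_integral_def eq by (simp only: integral_complex_of_real of_real_eq_0_iff)
  moreover have "AE z in lborel. 0 \<le> indicator S z *\<^sub>R (norm (d z))\<^sup>2" by simp
  ultimately have "AE z in lborel. indicator S z *\<^sub>R (norm (d z))\<^sup>2 = 0"
    using integral_nonneg_eq_0_iff_AE[OF i] by blast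
  then have ae: "AE z in lborel. z \<notin> {z \<in> S. d z \<noteq> 0}"
    by eventually_elim (auto simp: indicator_def split: if_splits)
  have op: "open {z \<in> S. d z \<noteq> 0}"
  proof -
    have "{z \<in> S. d z \<noteq> 0} = S \<inter> d -` (- {0})" by auto
    then show ?thesis using continuous_open_preimage[OF d S, of "- {0}"] by auto
  qed
  have "{z \<in> S. d z \<noteq> 0} \<in> null_sets lborel"
    using ae op by (subst AE_iff_null_sets) auto
  then have "negligible {z \<in> S. d z \<noteq> 0}"
    by (simp add: negligible_iff_null_sets null_sets_completionI)
  then have "{z \<in> S. d z \<noteq> 0} = {}" using open_not_negligible[OF op] by blast
  then show ?thesis using z by blast
qed

section \<open>Bergman spaces and the Bergman projection\<close>

lemma holomorphic2_on_imp_continuous_on: "holomorphic2_on f S \<Longrightarrow> continuous_on S f"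
  unfolding holomorphic2_on_def
  by (intro continuous_at_imp_continuous_on) (blast dest: has_derivative_continuous)

lemma holomorphic2_on_fst:
  assumes f: "holomorphic2_on f S" and T: "\<And>z. z \<in> T \<Longrightarrow> (z, w) \<in> S"
  shows "(\<lambda>z. f (z, w)) holomorphic_on T"
  unfolding holomorphic_on_def field_differentiable_def
proof
  fix z assume "z \<in> T"
  then obtain a b where d: "(f has_derivative (\<lambda>h. a * fst h + b * snd h)) (at (z, w))"
    using f T unfolding holomorphic2_on_def by blast
  have "((\<lambda>z. (z, w)) has_derivative (\<lambda>h. (h, 0))) (at z within T)"
    by (auto intro!: derivative_eq_intros)
  from has_derivative_compose[OF this d] have "((\<lambda>z. f (z, w)) has_derivative (\<lambda>h. a * h)) (at z within T)"
    by simp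
  then show "\<exists>d. ((\<lambda>z. f (z, w)) has_field_derivative d) (at z within T)"
    unfolding has_field_derivative_def by blast
qed

lemma holomorphic2_on_snd:
  assumes f: "holomorphic2_on f S" and T: "\<And>w. w \<in> T \<Longrightarrow> (z, w) \<in> S"
  shows "(\<lambda>w. f (z, w)) holomorphic_on T"
  unfolding holomorphic_on_def field_differentiable_def
proof
  fix w assume "w \<in> T"
  then obtain a b where d: "(f has_derivative (\<lambda>h. a * fst h + b * snd h)) (at (z, w))"
    using f T unfolding holomorphic2_on_def by blast
  have "((\<lambda>w. (z, w)) has_derivative (\<lambda>h. (0, h))) (at w within T)"
    by (auto intro!: derivative_eq_intros)
  from has_derivative_compose[OF this d] have "((\<lambda>w. f (z, w)) has_derivative (\<lambda>h. b * h)) (at w within T)"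
    by simp
  then show "\<exists>d. ((\<lambda>w. f (z, w)) has_field_derivative d) (at w within T)"
    unfolding has_field_derivative_def by blast
qed

lemma bergman_spaceD:
  assumes "f \<in> bergman_space p \<Omega>"
  shows "holomorphic2_on f \<Omega>" "continuous_on \<Omega> f" "f \<in> Lp_space p \<Omega>" "\<And>z. z \<notin> \<Omega> \<Longrightarrow> f z = 0"
  using assms holomorphic2_on_imp_continuous_on by (auto simp: bergman_space_def)

text \<open>Two candidates \<open>h\<close> and \<open>k\<close> have the same inner product with every element of \<open>A\<^sup>2\<close>, in particular
  with \<open>h\<close> and with \<open>k\<close>; expanding the square shows that \<open>k - h\<close> has norm zero.\<close>

lemma bergman_projection_eqI:
  assumes \<Omega>: "open \<Omega>" and f: "continuous_on \<Omega> f" "f \<in> Lp_space 2 \<Omega>"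
    and h: "h \<in> bergman_space 2 \<Omega>"
    and eq: "\<And>g. g \<in> bergman_space 2 \<Omega> \<Longrightarrow>
      (LINT z:\<Omega>|lborel. f z * cnj (g z)) = (LINT z:\<Omega>|lborel. h z * cnj (g z))"
  shows "bergman_projection \<Omega> f = h"
proof -
  have int: "set_integrable lborel \<Omega> (\<lambda>z. a z * cnj (b z))"
    if "continuous_on \<Omega> a" "a \<in> Lp_space 2 \<Omega>" "b \<in> bergman_space 2 \<Omega>" for a b
    using that bergman_spaceD[OF that(3)] Lp_space_2_cnj[OF \<Omega>, of b]
    by (intro set_integrable_mult_square_integrable \<Omega>) (auto simp: Lp_space_2_continuous_iff[OF \<Omega>])
  have inner: "L2_inner \<Omega> (\<lambda>z. f z - k z) g = (LINT z:\<Omega>|lborel. f z * cnj (g z)) - (LINT z:\<Omega>|lborel. k z * cnj (g z))"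
    if k: "k \<in> bergman_space 2 \<Omega>" and g: "g \<in> bergman_space 2 \<Omega>" for k g
  proof -
    have "L2_inner \<Omega> (\<lambda>z. f z - k z) g = (LINT z:\<Omega>|lborel. (f z - k z) * cnj (g z))"
      by (rule L2_inner_continuous[OF \<Omega>]) (intro continuous_intros f bergman_spaceD(2)[OF k] bergman_spaceD(2)[OF g])+
    also have "\<dots> = (LINT z:\<Omega>|lborel. f z * cnj (g z) - k z * cnj (g z))" by (simp add: algebra_simps)
    also have "\<dots> = (LINT z:\<Omega>|lborel. f z * cnj (g z)) - (LINT z:\<Omega>|lborel. k z * cnj (g z))"
      by (rule set_integral_diff(2)) (intro int f g bergman_spaceD(2,3)[OF k])+
    finally show ?thesis .
  qed
  show ?thesis
    unfolding bergman_projection_def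
  proof (rule the_equality)
    show "h \<in> bergman_space 2 \<Omega> \<and> (\<forall>g\<in>bergman_space 2 \<Omega>. L2_inner \<Omega> (\<lambda>z. f z - h z) g = 0)"
      using h eq by (simp add: inner)
  next
    fix k assume k: "k \<in> bergman_space 2 \<Omega> \<and> (\<forall>g\<in>bergman_space 2 \<Omega>. L2_inner \<Omega> (\<lambda>z. f z - k z) g = 0)"
    then have k1: "k \<in> bergman_space 2 \<Omega>" by simp
    define d where "d = (\<lambda>z. k z - h z)"
    have eqk: "(LINT z:\<Omega>|lborel. k z * cnj (g z)) = (LINT z:\<Omega>|lborel. h z * cnj (g z))"
      if g: "g \<in> bergman_space 2 \<Omega>" for g
      using k inner[OF k1 g] eq[OF g] g by simp
    note ik = int[OF bergman_spaceD(2,3)[OF k1]] and ih = int[OF bergman_spaceD(2,3)[OF h]]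
    have dd: "d z * cnj (d z) = (k z * cnj (k z) - h z * cnj (k z)) - (k z * cnj (h z) - h z * cnj (h z))" for z
      by (simp add: d_def algebra_simps)
    have "(LINT z:\<Omega>|lborel. d z * cnj (d z)) = 0"
      unfolding dd using ik ih k1 h by (simp add: set_integral_diff eqk)
    moreover have "set_integrable lborel \<Omega> (\<lambda>z. d z * cnj (d z))"
      unfolding dd by (intro set_integral_diff ik ih k1 h)
    moreover have "continuous_on \<Omega> d"
      unfolding d_def by (intro continuous_intros bergman_spaceD(2)[OF k1] bergman_spaceD(2)[OF h])
    ultimately have d0: "d z = 0" if "z \<in> \<Omega>" for z
      using continuous_eq_0_if_L2_norm_0[OF \<Omega>] that by blast
    show "k = h"
    proof
      fix z show "k z = h z"
        using d0[of z] bergman_spaceD(4)[OF k1, of z] bergman_spaceD(4)[OF h, of z] by (cases "z \<in> \<Omega>") (auto simp: d_def)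
    qed
  qed
qed

lemma bergman_projection_bergman_space:
  assumes "open \<Omega>" "f \<in> bergman_space 2 \<Omega>"
  shows "bergman_projection \<Omega> f = f"
  using assms bergman_spaceD[OF assms(2)] by (intro bergman_projection_eqI) auto

section \<open>Integration over the Hartogs triangle\<close>

lemma hartogs_triangle_iff: "(z, w) \<in> hartogs_triangle \<longleftrightarrow> z \<in> ball 0 (norm w) \<and> w \<in> ball 0 1"
  by (auto simp: hartogs_triangle_def)

lemma open_hartogs_triangle: "open hartogs_triangle"
proof -
  have "hartogs_triangle = {p. norm (fst p) < norm (snd p)} \<inter> {p. norm (snd p) < 1}"
    by (auto simp: hartogs_triangle_def)
  also have "open \<dots>" by (intro open_Int open_Collect_less continuous_intros)
  finally show ?thesis .
qed

lemma borel_hartogs_triangle [measurable]: "hartogs_triangle \<in> sets borel"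
  using open_hartogs_triangle by auto

text \<open>Fubini's theorem with the mean value property on each slice, followed by a rotation average in the
  second coordinate. Only holomorphy in the first coordinate enters, so that the integrand may contain
  conjugates of functions of the second.\<close>

lemma hartogs_integral_average:
  fixes F :: "complex \<times> complex \<Rightarrow> complex"
  assumes cont: "continuous_on hartogs_triangle F"
    and int: "set_integrable lborel hartogs_triangle F"
    and hol: "\<And>w. w \<in> ball 0 1 - {0} \<Longrightarrow> (\<lambda>z. F (z, w)) holomorphic_on ball 0 (norm w)"
  shows "(LINT p:hartogs_triangle|lborel. F p)
    = (LINT w:ball 0 1 - {0}|lborel. of_real (pi * (norm w)\<^sup>2) * (LINT t:{0..1}|lborel. F (0, rot t * w)))"
proof -
  define G where "G = (\<lambda>p. indicator hartogs_triangle p *\<^sub>R F p)"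
  have intG: "integrable (lborel \<Otimes>\<^sub>M lborel) (\<lambda>(z,w). G (z,w))"
    using int by (simp add: case_prod_eta lborel_prod) (simp add: G_def set_integrable_def)
  have slice: "(\<lambda>z. G (z, w)) = (\<lambda>z. indicator (ball 0 1) w *\<^sub>R (indicator (ball 0 (norm w)) z *\<^sub>R F (z, w)))" for w
    by (auto simp: G_def fun_eq_iff hartogs_triangle_iff split: split_indicator)
  have inner: "AE w in lborel. (LINT z|lborel. G (z, w)) = indicator (ball 0 1) w *\<^sub>R (of_real (pi * (norm w)\<^sup>2) * F (0, w))"
    using lborel_pair.AE_integrable_snd[OF intG]
  proof eventually_elim
    case (elim w)
    show ?case
    proof (cases "w \<in> ball 0 1 - {0}")
      case True
      then have "set_integrable lborel (ball 0 (norm w)) (\<lambda>z. F (z, w))"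
        using elim unfolding slice by (simp add: set_integrable_def)
      from disc_mean_value[OF hol[OF True] this] show ?thesis
        using True unfolding slice by (simp add: set_lebesgue_integral_def)
    next
      case False
      then show ?thesis unfolding slice by (cases "w = 0") auto
    qed
  qed
  define g where "g = (\<lambda>w. indicator (ball 0 1) w *\<^sub>R (of_real (pi * (norm w)\<^sup>2) * F (0, w)))"
  have g_eq: "g = (\<lambda>w. indicator (ball 0 1 - {0}) w *\<^sub>R (of_real (pi * (norm w)\<^sup>2) * F (0, w)))"
    by (auto simp: g_def fun_eq_iff split: split_indicator)
  have g_meas: "g \<in> borel_measurable borel"
    unfolding g_eq
    by (intro borel_measurable_continuous_on_indicator continuous_intros continuous_on_compose2[OF cont])
       (auto simp: hartogs_triangle_iff)
  have int_inner: "integrable lborel (\<lambda>w. LINT z|lborel. G (z, w))"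
    using lborel_pair.integrable_snd[OF intG] by simp
  have inner': "AE w in lborel. (LINT z|lborel. G (z, w)) = g w"
    using inner by (simp add: g_def)
  have int_g: "integrable lborel g"
    using integrable_cong_AE[OF borel_measurable_integrable[OF int_inner] _ inner'] g_meas int_inner by simp
  have "(LINT p:hartogs_triangle|lborel. F p) = (LINT p|(lborel \<Otimes>\<^sub>M lborel). G p)"
    by (simp add: set_lebesgue_integral_def G_def lborel_prod)
  also have "\<dots> = (LINT w|lborel. (LINT z|lborel. G (z, w)))"
    using lborel_pair.integral_snd[OF intG] by simp
  also have "\<dots> = (LINT w|lborel. g w)"
    by (intro integral_cong_AE borel_measurable_integrable[OF int_inner] borel_measurable_integrable[OF int_g] inner')
  also have "\<dots> = (LINT w|lborel. (LINT t:{0..1}|lborel. g (rot t * w)))"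
    by (rule integral_rotation_average) (rule int_g)
  also have "\<dots> = (LINT w:ball 0 1 - {0}|lborel. of_real (pi * (norm w)\<^sup>2) * (LINT t:{0..1}|lborel. F (0, rot t * w)))"
    unfolding set_lebesgue_integral_def[of _ "ball 0 1 - {0}"]
  proof (rule Bochner_Integration.integral_cong)
    fix w :: complex
    show "(LINT t:{0..1}|lborel. g (rot t * w)) = indicator (ball 0 1 - {0}) w *\<^sub>R (of_real (pi * (norm w)\<^sup>2) * (LINT t:{0..1}|lborel. F (0, rot t * w)))"
      by (cases "w \<in> ball 0 1 - {0}") (auto simp: g_def norm_mult set_lebesgue_integral_def)
  qed simp
  finally show ?thesis .
qed

lemma nn_integral_hartogs_triangle:
  fixes F :: "complex \<times> complex \<Rightarrow> ennreal"
  assumes [measurable]: "(\<lambda>p. F p * indicator hartogs_triangle p) \<in> borel_measurable borel"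
  shows "(\<integral>\<^sup>+p. F p * indicator hartogs_triangle p \<partial>lborel)
    = (\<integral>\<^sup>+w. (\<integral>\<^sup>+z. F (z, w) * indicator (ball 0 (norm w)) z \<partial>lborel) * indicator (ball 0 1 - {0}) w \<partial>lborel)"
proof -
  define G where "G = (\<lambda>p. F p * indicator hartogs_triangle p)"
  have [measurable]: "G \<in> borel_measurable (lborel \<Otimes>\<^sub>M lborel)"
    using assms by (simp add: G_def lborel_prod)
  have "(\<integral>\<^sup>+p. F p * indicator hartogs_triangle p \<partial>lborel) = (\<integral>\<^sup>+p. G p \<partial>(lborel \<Otimes>\<^sub>M lborel))"
    by (simp add: G_def lborel_prod)
  also have "\<dots> = (\<integral>\<^sup>+w. (\<integral>\<^sup>+z. G (z, w) \<partial>lborel) \<partial>lborel)"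
    by (rule lborel_pair.nn_integral_snd[symmetric]) measurable
  also have "\<dots> = (\<integral>\<^sup>+w. (\<integral>\<^sup>+z. F (z, w) * indicator (ball 0 (norm w)) z \<partial>lborel) * indicator (ball 0 1 - {0}) w \<partial>lborel)"
  proof (rule nn_integral_cong)
    fix w :: complex
    have "G (z, w) = (if w \<in> ball 0 1 - {0} then F (z, w) * indicator (ball 0 (norm w)) z else 0)" for z
      by (auto simp: G_def hartogs_triangle_iff split: split_indicator)
    then show "(\<integral>\<^sup>+z. G (z, w) \<partial>lborel) = (\<integral>\<^sup>+z. F (z, w) * indicator (ball 0 (norm w)) z \<partial>lborel) * indicator (ball 0 1 - {0}) w"
      by (cases "w \<in> ball 0 1 - {0}") auto
  qed
  finally show ?thesis .
qed

section \<open>Laurent coefficients on the axis\<close>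

text \<open>The sub-mean value property for \<open>f\<^sup>2\<close> on the slice over \<open>w\<close>, whose area is \<open>pi * (norm w)\<^sup>2\<close>, supplies
  exactly the factor that makes \<open>w * f (0, w)\<close> square integrable.\<close>

lemma bergman_space_axis_extension:
  assumes f: "f \<in> bergman_space 2 hartogs_triangle"
  obtains v where "v holomorphic_on ball 0 1" "\<And>w. w \<in> ball 0 1 - {0} \<Longrightarrow> v w = w * f (0, w)"
proof (rule square_integrable_removable_singularity)
  note f' = bergman_spaceD[OF f]
  show "(\<lambda>w. w * f (0, w)) holomorphic_on ball 0 1 - {0}"
    by (intro holomorphic_intros holomorphic2_on_snd[OF f'(1)]) (auto simp: hartogs_triangle_iff)
  have f2: "set_integrable lborel hartogs_triangle (\<lambda>z. (norm (f z))\<^sup>2)"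
    using f' Lp_space_2_continuous_iff[OF open_hartogs_triangle] by auto
  have eq: "ennreal (indicator hartogs_triangle p *\<^sub>R (norm (f p))\<^sup>2) = ennreal ((norm (f p))\<^sup>2) * indicator hartogs_triangle p" for p
    by (auto split: split_indicator)
  have m: "(\<lambda>p. ennreal ((norm (f p))\<^sup>2) * indicator hartogs_triangle p) \<in> borel_measurable borel"
    using f2 unfolding eq[symmetric] set_integrable_def by (auto dest: borel_measurable_integrable)
  have "(\<integral>\<^sup>+w. ennreal ((norm (w * f (0, w)))\<^sup>2) * indicator (ball 0 1 - {0}) w \<partial>lborel)
    \<le> (\<integral>\<^sup>+w. (\<integral>\<^sup>+z. ennreal ((norm (f (z, w)))\<^sup>2) * indicator (ball 0 (norm w)) z \<partial>lborel) * indicator (ball 0 1 - {0}) w \<partial>lborel)"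
  proof (rule nn_integral_mono)
    fix w :: complex
    show "ennreal ((norm (w * f (0, w)))\<^sup>2) * indicator (ball 0 1 - {0}) w \<le> (\<integral>\<^sup>+z. ennreal ((norm (f (z, w)))\<^sup>2) * indicator (ball 0 (norm w)) z \<partial>lborel) * indicator (ball 0 1 - {0}) w"
    proof (cases "w \<in> ball 0 1 - {0}")
      case True
      have hol: "(\<lambda>z. (f (z, w))\<^sup>2) holomorphic_on ball 0 (norm w)"
        using True by (intro holomorphic_intros holomorphic2_on_fst[OF f'(1)]) (auto simp: hartogs_triangle_iff)
      have "1 * (norm (w * f (0, w)))\<^sup>2 \<le> pi * (norm (w * f (0, w)))\<^sup>2"
        using pi_gt3 by (intro mult_right_mono) auto
      then have "ennreal ((norm (w * f (0, w)))\<^sup>2) \<le> ennreal (pi * (norm w)\<^sup>2 * norm ((f (0, w))\<^sup>2))"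
        by (intro ennreal_leI) (simp add: norm_mult norm_power power_mult_distrib mult.assoc)
      also have "\<dots> \<le> (\<integral>\<^sup>+z. ennreal (norm ((f (z, w))\<^sup>2)) * indicator (ball 0 (norm w)) z \<partial>lborel)"
        by (rule disc_sub_mean_value[OF hol]) simp
      finally show ?thesis using True by (simp add: norm_power)
    qed auto
  qed
  also have "\<dots> = (\<integral>\<^sup>+p. ennreal ((norm (f p))\<^sup>2) * indicator hartogs_triangle p \<partial>lborel)"
    by (rule nn_integral_hartogs_triangle[symmetric]) (rule m)
  also have "\<dots> < \<infinity>"
    using f2 unfolding eq[symmetric] set_integrable_def integrable_iff_bounded by simp
  finally show "(\<integral>\<^sup>+w. ennreal ((norm (w * f (0, w)))\<^sup>2) * indicator (ball 0 1 - {0}) w \<partial>lborel) < \<infinity>" .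
qed (use that in blast)

text \<open>This is the Laurent coefficient of \<open>f (0, w)\<close> at exponent \<open>m - 1\<close>, equivalently the \<open>m\<close>-th Taylor
  coefficient of \<open>w * f (0, w)\<close>. Any radius less than \<open>1\<close> could take the place of \<open>1 / 2\<close>.\<close>

definition axis_coeff :: "(complex \<times> complex \<Rightarrow> complex) \<Rightarrow> nat \<Rightarrow> complex" where
  "axis_coeff f m = (LINT t:{0..1}|lborel. rot t / 2 * f (0, rot t / 2) / (rot t / 2) ^ m)"

lemma circle_mean_axis:
  assumes v: "v holomorphic_on ball 0 1" "\<And>w. w \<in> ball 0 1 - {0} \<Longrightarrow> v w = w * f (0, w)"
    and w: "w \<in> ball 0 1 - {0}"
  shows "(LINT t:{0..1}|lborel. rot t * w * f (0, rot t * w) / (rot t * w) ^ m) = (deriv ^^ m) v 0 / fact m"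
proof -
  have "(LINT t:{0..1}|lborel. rot t * w * f (0, rot t * w) / (rot t * w) ^ m) = (LINT t:{0..1}|lborel. v (rot t * w) / (rot t * w) ^ m)"
    using w by (simp add: v(2) norm_mult)
  also have "\<dots> = (deriv ^^ m) v 0 / fact m"
    by (rule circle_mean_Taylor_coeff[OF v(1)]) (use w in auto)
  finally show ?thesis .
qed

lemma axis_coeff_eq:
  assumes v: "v holomorphic_on ball 0 1" "\<And>w. w \<in> ball 0 1 - {0} \<Longrightarrow> v w = w * f (0, w)"
  shows "axis_coeff f m = (deriv ^^ m) v 0 / fact m"
  using circle_mean_axis[OF v, of "1/2" m] by (simp add: axis_coeff_def)

text \<open>The integral of \<open>norm z\<^sub>2 powr (2 * (m - 1))\<close> over the Hartogs triangle, after integration in \<open>z\<^sub>1\<close>.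
  In particular \<open>axis_weight 1\<close> is the volume.\<close>

definition axis_weight :: "nat \<Rightarrow> real" where
  "axis_weight m = (LINT w:ball 0 1 - {0::complex}|lborel. pi * norm w ^ (2 * m))"

lemma axis_weight_integrable: "set_integrable lborel (ball 0 1 - {0::complex}) (\<lambda>w. pi * norm w ^ (2 * m))"
proof (rule set_integrable_bound)
  have "emeasure lborel (ball 0 1 - {0::complex}) \<le> emeasure lborel (ball (0::complex) 1)"
    by (intro emeasure_mono) auto
  then have "emeasure lborel (ball 0 1 - {0::complex}) < \<infinity>"
    by (simp add: emeasure_disc le_less_trans)
  then show "set_integrable lborel (ball 0 1 - {0::complex}) (\<lambda>w. pi)"
    unfolding set_integrable_def by (intro integrable_scaleR_left integrable_real_indicator) auto
  show "set_borel_measurable lborel (ball 0 1 - {0::complex}) (\<lambda>w. pi * norm w ^ (2 * m))"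
    by (intro set_borel_measurable_continuous_open continuous_intros) auto
qed (auto intro!: power_le_one)

lemma axis_weight_pos: "axis_weight m > 0"
proof -
  let ?h = "\<lambda>w::complex. indicator (ball 0 1 - {0}) w *\<^sub>R (pi * norm w ^ (2 * m))"
  have int: "integrable lborel ?h" using axis_weight_integrable by (simp add: set_integrable_def)
  have "axis_weight m \<noteq> 0"
  proof
    assume "axis_weight m = 0"
    then have "(LINT w|lborel. ?h w) = 0"
      unfolding axis_weight_def set_lebesgue_integral_def .
    moreover have "AE w in lborel. 0 \<le> ?h w" by simp
    ultimately have "AE w in lborel. ?h w = 0"
      using integral_nonneg_eq_0_iff_AE[OF int] by blast
    moreover have "AE w in lborel. w \<noteq> (0::complex)" by (rule AE_lborel_singleton)
    ultimately have "AE w in lborel. w \<notin> ball (0::complex) 1"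
      by eventually_elim (auto simp: indicator_def split: if_splits)
    then have "emeasure lborel (ball (0::complex) 1) = 0"
      by (subst AE_iff_measurable[symmetric, where P = "\<lambda>w. w \<notin> ball 0 1"]) (auto simp: space_lborel)
    then show False by (simp add: emeasure_disc)
  qed
  moreover have "axis_weight m \<ge> 0"
    unfolding axis_weight_def set_lebesgue_integral_def by (intro Bochner_Integration.integral_nonneg) auto
  ultimately show ?thesis by linarith
qed

lemma axis_weight_complex:
  "(LINT w:ball 0 1 - {0::complex}|lborel. of_real (pi * norm w ^ (2 * m)) * c) = of_real (axis_weight m) * (c::complex)"
  unfolding axis_weight_def set_integral_complex_of_real[symmetric] by simp

lemma set_integrable_hartogs_mult:
  assumes f: "f \<in> Lp_space 2 hartogs_triangle" "continuous_on hartogs_triangle f"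
    and g: "g \<in> Lp_space 2 hartogs_triangle" "continuous_on hartogs_triangle g"
  shows "set_integrable lborel hartogs_triangle (\<lambda>z. f z * g z)"
  using assms Lp_space_2_continuous_iff[OF open_hartogs_triangle]
  by (intro set_integrable_mult_square_integrable[OF open_hartogs_triangle]) auto

text \<open>On the axis the product is \<open>u w * v w / w\<^sup>2\<close> with \<open>u\<close> and \<open>v\<close> holomorphic at \<open>0\<close>, and its circular
  mean is the second Taylor coefficient of \<open>u * v\<close>. Only the first three coefficients of each factor
  survive, which is why the Friedrichs operator has finite rank.\<close>

lemma integral_bergman_mult:
  assumes f: "f \<in> bergman_space 2 hartogs_triangle" and g: "g \<in> bergman_space 2 hartogs_triangle"
  shows "(LINT p:hartogs_triangle|lborel. f p * g p)
    = of_real (axis_weight 1) * (\<Sum>i\<le>2. axis_coeff f i * axis_coeff g (2 - i))"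
proof -
  note f' = bergman_spaceD[OF f] and g' = bergman_spaceD[OF g]
  obtain u where u: "u holomorphic_on ball 0 1" "\<And>w. w \<in> ball 0 1 - {0} \<Longrightarrow> u w = w * f (0, w)"
    using bergman_space_axis_extension[OF f] by blast
  obtain v where v: "v holomorphic_on ball 0 1" "\<And>w. w \<in> ball 0 1 - {0} \<Longrightarrow> v w = w * g (0, w)"
    using bergman_space_axis_extension[OF g] by blast
  define c where "c = (deriv ^^ 2) (\<lambda>w. u w * v w) 0 / fact 2"
  have c: "c = (\<Sum>i\<le>2. axis_coeff f i * axis_coeff g (2 - i))"
  proof -
    have a: "axis_coeff f i = (deriv ^^ i) u 0 / fact i" for i by (rule axis_coeff_eq[OF u])
    have b: "axis_coeff g i = (deriv ^^ i) v 0 / fact i" for i by (rule axis_coeff_eq[OF v])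
    have c': "c = (\<Sum>i=0..2. of_nat (2 choose i) * (deriv ^^ i) u 0 * (deriv ^^ (2 - i)) v 0) / fact 2"
      unfolding c_def by (subst higher_deriv_mult[OF u(1) v(1)]) auto
    show ?thesis
      unfolding c' a b by (simp add: atMost_atLeast0 numeral_2_eq_2 field_simps)
  qed
  have "(LINT p:hartogs_triangle|lborel. f p * g p)
    = (LINT w:ball 0 1 - {0}|lborel. of_real (pi * (norm w)\<^sup>2) * (LINT t:{0..1}|lborel. f (0, rot t * w) * g (0, rot t * w)))"
    by (rule hartogs_integral_average)
       (auto intro!: continuous_intros holomorphic_intros set_integrable_hartogs_mult f' g' holomorphic2_on_fst[OF f'(1)] holomorphic2_on_fst[OF g'(1)] simp: hartogs_triangle_iff)
  also have "\<dots> = (LINT w:ball 0 1 - {0::complex}|lborel. of_real (pi * norm w ^ (2 * 1)) * c)"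
  proof (rule set_lebesgue_integral_cong, simp, intro allI impI)
    fix w :: complex assume w: "w \<in> ball 0 1 - {0}"
    have "(LINT t:{0..1}|lborel. f (0, rot t * w) * g (0, rot t * w)) = (LINT t:{0..1}|lborel. u (rot t * w) * v (rot t * w) / (rot t * w) ^ 2)"
      using w by (simp add: u(2) v(2) norm_mult power2_eq_square)
    also have "\<dots> = c" unfolding c_def
      by (rule circle_mean_Taylor_coeff[of _ 1]) (use w in \<open>auto intro!: holomorphic_intros u v\<close>)
    finally show "of_real (pi * (norm w)\<^sup>2) * (LINT t:{0..1}|lborel. f (0, rot t * w) * g (0, rot t * w)) = of_real (pi * norm w ^ (2 * 1)) * c"
      by simp
  qed
  also have "\<dots> = of_real (axis_weight 1) * c" by (rule axis_weight_complex)
  finally show ?thesis by (simp add: c)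
qed

definition hartogs_lift :: "(complex \<Rightarrow> complex) \<Rightarrow> complex \<times> complex \<Rightarrow> complex" where
  "hartogs_lift g p = (if p \<in> hartogs_triangle then g (snd p) else 0)"

text \<open>The exponent is shifted by one, with index \<open>0\<close> for \<open>1/z\<^sub>2\<close>, to match the indexing of the Laurent
  coefficients.\<close>

definition axis_monomial :: "nat \<Rightarrow> complex \<times> complex \<Rightarrow> complex" where
  "axis_monomial m = hartogs_lift (\<lambda>w. w ^ m / w)"

text \<open>On a circle of radius \<open>r\<close> the conjugate of \<open>w ^ k\<close> is \<open>r ^ (2 * k) / w ^ k\<close>, and so integrating against
  a conjugated power of \<open>z\<^sub>2\<close> extracts a single Laurent coefficient.\<close>

lemma integral_bergman_cnj_monomial:
  assumes f: "f \<in> bergman_space 2 hartogs_triangle"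
    and e: "axis_monomial m \<in> bergman_space 2 hartogs_triangle"
  shows "(LINT p:hartogs_triangle|lborel. f p * cnj (axis_monomial m p)) = of_real (axis_weight m) * axis_coeff f m"
proof -
  note f' = bergman_spaceD[OF f] and e' = bergman_spaceD[OF e]
  obtain u where u: "u holomorphic_on ball 0 1" "\<And>w. w \<in> ball 0 1 - {0} \<Longrightarrow> u w = w * f (0, w)"
    using bergman_space_axis_extension[OF f] by blast
  have ce: "(\<lambda>p. cnj (axis_monomial m p)) \<in> Lp_space 2 hartogs_triangle" "continuous_on hartogs_triangle (\<lambda>p. cnj (axis_monomial m p))"
    using e' by (auto intro!: continuous_intros simp: Lp_space_2_continuous_iff[OF open_hartogs_triangle])
  have "(LINT p:hartogs_triangle|lborel. f p * cnj (axis_monomial m p))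
    = (LINT w:ball 0 1 - {0}|lborel. of_real (pi * (norm w)\<^sup>2) * (LINT t:{0..1}|lborel. f (0, rot t * w) * cnj (axis_monomial m (0, rot t * w))))"
  proof (rule hartogs_integral_average)
    fix w :: complex assume w: "w \<in> ball 0 1 - {0}"
    have "(\<lambda>z. f (z, w) * cnj (w ^ m / w)) holomorphic_on ball 0 (norm w)"
      using w by (intro holomorphic_intros holomorphic2_on_fst[OF f'(1)]) (auto simp: hartogs_triangle_iff)
    then show "(\<lambda>z. f (z, w) * cnj (axis_monomial m (z, w))) holomorphic_on ball 0 (norm w)"
      by (rule holomorphic_transform) (use w in \<open>auto simp: axis_monomial_def hartogs_lift_def hartogs_triangle_iff\<close>)
  qed (auto intro!: continuous_intros set_integrable_hartogs_mult f' ce)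
  also have "\<dots> = (LINT w:ball 0 1 - {0::complex}|lborel. of_real (pi * norm w ^ (2 * m)) * axis_coeff f m)"
  proof (rule set_lebesgue_integral_cong, simp, intro allI impI)
    fix w :: complex assume w: "w \<in> ball 0 1 - {0}"
    have cn: "f (0, x) * cnj (axis_monomial m (0, x)) = of_real (norm w ^ (2 * m) / (norm w)\<^sup>2) * (x * f (0, x) / x ^ m)"
      if x: "norm x = norm w" for x
    proof -
      have x0: "x \<noteq> 0" and xH: "(0, x) \<in> hartogs_triangle" using x w by (auto simp: hartogs_triangle_iff)
      have n2: "of_real ((norm w)\<^sup>2) = x * cnj x"
        using complex_norm_square[of x] x by simp
      then have n2m: "of_real (norm w ^ (2 * m)) = (x * cnj x) ^ m"
        by (metis of_real_power power_mult)
      show ?thesis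
        unfolding of_real_divide n2 n2m using x0 xH
        by (simp add: axis_monomial_def hartogs_lift_def power_mult_distrib field_simps)
    qed
    have "(LINT t:{0..1}|lborel. f (0, rot t * w) * cnj (axis_monomial m (0, rot t * w)))
      = (LINT t:{0..1}|lborel. of_real (norm w ^ (2 * m) / (norm w)\<^sup>2) * (rot t * w * f (0, rot t * w) / (rot t * w) ^ m))"
      by (simp add: cn norm_mult)
    also have "\<dots> = of_real (norm w ^ (2 * m) / (norm w)\<^sup>2) * axis_coeff f m"
      using axis_coeff_eq[OF u, of m] circle_mean_axis[OF u w, of m] by (simp only: set_integral_mult_right)
    finally show "of_real (pi * (norm w)\<^sup>2) * (LINT t:{0..1}|lborel. f (0, rot t * w) * cnj (axis_monomial m (0, rot t * w))) = of_real (pi * norm w ^ (2 * m)) * axis_coeff f m"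
      using w by (simp add: field_simps)
  qed
  also have "\<dots> = of_real (axis_weight m) * axis_coeff f m" by (rule axis_weight_complex)
  finally show ?thesis .
qed

section \<open>Functions of the second coordinate\<close>

lemma dyadic_scale:
  assumes "0 < x" "x < (r::real)"
  obtains k where "r / 2 ^ Suc k \<le> x" "x < r / 2 ^ k"
proof -
  have "0 < x / r" using assms by simp
  then obtain n0 where n0: "(1/2) ^ n0 < x / r" using real_arch_pow_inv[of "x/r" "1/2"] by auto
  define n where "n = (LEAST n. r / 2 ^ n \<le> x)"
  have "r / 2 ^ n \<le> x" unfolding n_def
    by (rule LeastI[of _ n0]) (use n0 assms in \<open>simp add: field_simps power_one_over\<close>)
  moreover from this have "n \<noteq> 0" using assms by (intro notI) simp
  then obtain k where k: "n = Suc k" by (cases n) auto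
  moreover have "\<not> r / 2 ^ k \<le> x"
    using not_less_Least[of k "\<lambda>n. r / 2 ^ n \<le> x"] k unfolding n_def by auto
  ultimately show ?thesis using that[of k] by auto
qed

text \<open>On the dyadic annulus with outer radius \<open>r / 2 ^ k\<close> the integrand is at most a constant times
  \<open>2 powr (s * k)\<close> and the area is at most a constant times \<open>4 powr (- k)\<close>, which leaves a convergent
  geometric series.\<close>

lemma nn_integral_norm_powr_finite:
  fixes c :: complex
  assumes s: "0 \<le> s" "s < 2" and r: "0 < r"
  shows "(\<integral>\<^sup>+w. ennreal (norm (w - c) powr (-s)) * indicator (ball c r - {c}) w \<partial>lborel) < \<infinity>"
proof -
  define C where "C = (\<lambda>k. (r / 2 ^ Suc k) powr (-s))"
  define B where "B = (\<lambda>k::nat. ball c (r / 2 ^ k))"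
  have "(\<integral>\<^sup>+w. ennreal (norm (w - c) powr (-s)) * indicator (ball c r - {c}) w \<partial>lborel)
     \<le> (\<integral>\<^sup>+w. (\<Sum>k. ennreal (C k) * indicator (B k) w) \<partial>lborel)"
  proof (rule nn_integral_mono)
    fix w
    show "ennreal (norm (w - c) powr (-s)) * indicator (ball c r - {c}) w \<le> (\<Sum>k. ennreal (C k) * indicator (B k) w)"
    proof (cases "w \<in> ball c r - {c}")
      case True
      then obtain k where k: "r / 2 ^ Suc k \<le> norm (w - c)" "norm (w - c) < r / 2 ^ k"
        using dyadic_scale[of "norm (w - c)" r] by (auto simp: dist_norm norm_minus_commute)
      have "norm (w - c) powr (-s) \<le> C k"
        unfolding C_def using k r s by (intro powr_mono2') auto
      then have "ennreal (norm (w - c) powr (-s)) \<le> ennreal (C k) * indicator (B k) w"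
        using k by (simp add: B_def dist_norm norm_minus_commute ennreal_leI)
      also have "\<dots> = (\<Sum>i\<in>{k}. ennreal (C i) * indicator (B i) w)"
        by (subst sum.insert) (simp_all only: sum.empty add_0_right finite.emptyI empty_iff not_False_eq_True)
      also have "\<dots> \<le> (\<Sum>i. ennreal (C i) * indicator (B i) w)"
        by (rule sum_le_suminf) auto
      finally show ?thesis using True by simp
    qed auto
  qed
  also have "\<dots> = (\<Sum>k. ennreal (C k) * emeasure lborel (B k))"
  proof -
    have [measurable]: "B k \<in> sets borel" for k by (simp add: B_def)
    show ?thesis by (subst nn_integral_suminf) (auto simp: nn_integral_cmult_indicator)
  qed
  also have "\<dots> = (\<Sum>k. ennreal (C k * (pi * (r / 2 ^ k)\<^sup>2)))"
    using r by (intro suminf_cong) (simp add: B_def emeasure_disc ennreal_mult'' C_def)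
  also have "\<dots> < \<infinity>"
  proof -
    have eq: "C k * (pi * (r / 2 ^ k)\<^sup>2) = (pi * r powr (2 - s) * 2 powr s) * (2 powr (s - 2)) ^ k" for k
    proof -
      have "C k = r powr (-s) * (2 powr s * (2 powr s) ^ k)"
        using r by (simp add: C_def powr_divide powr_mult powr_minus powr_power field_simps powr_powr flip: powr_realpow)
      moreover have "(r / 2 ^ k)\<^sup>2 = r powr 2 * (2 powr (-2)) ^ k"
        using r power_mult[of "2::real" 2 k] by (simp add: powr_minus power_divide power_inverse field_simps power_mult[symmetric] mult.commute[of 2 k])
      moreover have "(2 powr s) ^ k * (2 powr (-2)) ^ k = (2 powr (s - 2)) ^ k"
        by (simp add: power_mult_distrib[symmetric] powr_add[symmetric])
      moreover have "r powr (-s) * r powr 2 = r powr (2 - s)" by (simp add: powr_add[symmetric])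
      ultimately show ?thesis by (simp add: mult_ac)
    qed
    have "2 powr (s - 2) < (1::real)" using s by (simp add: powr_less_one)
    then have "summable (\<lambda>k. C k * (pi * (r / 2 ^ k)\<^sup>2))"
      unfolding eq by (intro summable_mult summable_geometric) auto
    then have "(\<Sum>k. ennreal (C k * (pi * (r / 2 ^ k)\<^sup>2))) \<noteq> top"
      by (rule ennreal_suminf_neq_top) (simp add: C_def)
    then show ?thesis by (simp add: top.not_eq_extremum)
  qed
  finally show ?thesis .
qed

lemma holomorphic2_on_snd_compose:
  assumes S: "open S" and g: "g holomorphic_on T" and T: "open T" "\<And>p. p \<in> S \<Longrightarrow> snd p \<in> T"
  shows "holomorphic2_on (\<lambda>p. if p \<in> S then g (snd p) else 0) S"
  unfolding holomorphic2_on_def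
proof
  fix p assume p: "p \<in> S"
  have "(g has_field_derivative deriv g (snd p)) (at (snd p))"
    using holomorphic_derivI[OF g T(1)] T(2)[OF p] by blast
  then have "(g has_derivative (\<lambda>h. deriv g (snd p) * h)) (at (snd p))"
    by (simp add: has_field_derivative_def)
  then have "((\<lambda>p. g (snd p)) has_derivative (\<lambda>h. 0 * fst h + deriv g (snd p) * snd h)) (at p)"
    using has_derivative_compose[OF has_derivative_snd[OF has_derivative_ident]] by fastforce
  then have "((\<lambda>p. if p \<in> S then g (snd p) else 0) has_derivative (\<lambda>h. 0 * fst h + deriv g (snd p) * snd h)) (at p)"
    by (rule has_derivative_transform_within_open[OF _ S p]) auto
  then show "\<exists>a b. ((\<lambda>p. if p \<in> S then g (snd p) else 0) has_derivative (\<lambda>h. a * fst h + b * snd h)) (at p)"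
    by blast
qed

lemma holomorphic2_on_hartogs_lift:
  assumes g: "g holomorphic_on ball 0 1 - {0}"
  shows "holomorphic2_on (hartogs_lift g) hartogs_triangle"
  unfolding hartogs_lift_def
  by (rule holomorphic2_on_snd_compose[OF open_hartogs_triangle g]) (auto simp: hartogs_triangle_def)

lemma bergman_space_hartogs_lift_iff:
  assumes g: "g holomorphic_on ball 0 1 - {0}" and p: "p > 0"
  shows "hartogs_lift g \<in> bergman_space p hartogs_triangle \<longleftrightarrow>
    (\<integral>\<^sup>+w. ennreal (pi * (norm w)\<^sup>2 * norm (g w) powr p) * indicator (ball 0 1 - {0}) w \<partial>lborel) < \<infinity>"
proof -
  let ?f = "hartogs_lift g"
  note hol = holomorphic2_on_hartogs_lift[OF g]
  note cont = holomorphic2_on_imp_continuous_on[OF hol]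
  have m: "(\<lambda>z. indicator hartogs_triangle z *\<^sub>R (norm (?f z) powr p)) \<in> borel_measurable borel"
    by (intro borel_measurable_continuous_on_indicator continuous_on_norm_powr cont p borel_hartogs_triangle)
  have eq: "ennreal (norm (indicator hartogs_triangle z *\<^sub>R (norm (?f z) powr p))) = ennreal (norm (?f z) powr p) * indicator hartogs_triangle z" for z
    by (auto split: split_indicator)
  have m': "(\<lambda>z. ennreal (norm (?f z) powr p) * indicator hartogs_triangle z) \<in> borel_measurable borel"
    unfolding eq[symmetric] using m by measurable
  have "?f \<in> bergman_space p hartogs_triangle \<longleftrightarrow> set_integrable lborel hartogs_triangle (\<lambda>z. norm (?f z) powr p)"
    using hol Lp_space_continuous_iff[OF open_hartogs_triangle cont p] by (auto simp: bergman_space_def hartogs_lift_def)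
  also have "\<dots> \<longleftrightarrow> (\<integral>\<^sup>+z. ennreal (norm (?f z) powr p) * indicator hartogs_triangle z \<partial>lborel) < \<infinity>"
    unfolding set_integrable_def integrable_iff_bounded eq using m by simp
  also have "(\<integral>\<^sup>+z. ennreal (norm (?f z) powr p) * indicator hartogs_triangle z \<partial>lborel)
    = (\<integral>\<^sup>+w. (\<integral>\<^sup>+z. ennreal (norm (?f (z, w)) powr p) * indicator (ball 0 (norm w)) z \<partial>lborel) * indicator (ball 0 1 - {0}) w \<partial>lborel)"
    by (rule nn_integral_hartogs_triangle) (rule m')
  also have "\<dots> = (\<integral>\<^sup>+w. ennreal (pi * (norm w)\<^sup>2 * norm (g w) powr p) * indicator (ball 0 1 - {0}) w \<partial>lborel)"
  proof (rule nn_integral_cong)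
    fix w :: complex
    have "(\<integral>\<^sup>+z. ennreal (norm (?f (z, w)) powr p) * indicator (ball 0 (norm w)) z \<partial>lborel) = ennreal (pi * (norm w)\<^sup>2 * norm (g w) powr p)"
      if w: "w \<in> ball 0 1 - {0}"
    proof -
      have "(\<integral>\<^sup>+z. ennreal (norm (?f (z, w)) powr p) * indicator (ball 0 (norm w)) z \<partial>lborel)
         = (\<integral>\<^sup>+z. ennreal (norm (g w) powr p) * indicator (ball (0::complex) (norm w)) z \<partial>lborel)"
        using w by (intro nn_integral_cong) (auto simp: hartogs_lift_def hartogs_triangle_iff split: split_indicator)
      also have "\<dots> = ennreal (pi * (norm w)\<^sup>2 * norm (g w) powr p)"
        by (simp add: nn_integral_cmult_indicator emeasure_disc ennreal_mult' mult.commute)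
      finally show ?thesis .
    qed
    then show "(\<integral>\<^sup>+z. ennreal (norm (?f (z, w)) powr p) * indicator (ball 0 (norm w)) z \<partial>lborel) * indicator (ball 0 1 - {0}) w
      = ennreal (pi * (norm w)\<^sup>2 * norm (g w) powr p) * indicator (ball 0 1 - {0}) w"
      by (cases "w \<in> ball 0 1 - {0}") auto
  qed
  finally show ?thesis .
qed

text \<open>The exponent \<open>4\<close> comes from here: the slice area contributes \<open>(norm w)\<^sup>2\<close>, and
  \<open>norm w powr (2 - p)\<close> is integrable near \<open>0\<close> in the plane exactly for \<open>p < 4\<close>.\<close>

lemma hartogs_lift_bergman:
  assumes g: "g holomorphic_on ball 0 1 - {0}" and K: "\<And>w. w \<in> ball 0 1 - {0} \<Longrightarrow> norm (g w) \<le> K / norm w"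
    and p: "2 \<le> p" "p < 4"
  shows "hartogs_lift g \<in> bergman_space p hartogs_triangle"
proof -
  have [measurable]: "(\<lambda>w::complex. norm (w - 0)) \<in> borel_measurable borel"
    by (intro borel_measurable_continuous_onI continuous_intros)
  have [measurable]: "ball (0::complex) 1 - {0} \<in> sets borel" by auto
  have "(\<integral>\<^sup>+w. ennreal (pi * (norm w)\<^sup>2 * norm (g w) powr p) * indicator (ball (0::complex) 1 - {0}) w \<partial>lborel)
    \<le> (\<integral>\<^sup>+w. ennreal (pi * K powr p) * (ennreal (norm (w - 0) powr (- (p - 2))) * indicator (ball (0::complex) 1 - {0}) w) \<partial>lborel)"
  proof (rule nn_integral_mono)
    fix w :: complex
    show "ennreal (pi * (norm w)\<^sup>2 * norm (g w) powr p) * indicator (ball (0::complex) 1 - {0}) w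
      \<le> ennreal (pi * K powr p) * (ennreal (norm (w - 0) powr (- (p - 2))) * indicator (ball (0::complex) 1 - {0}) w)"
    proof (cases "w \<in> ball 0 1 - {0}")
      case True
      have "0 \<le> K / norm w" using K[OF True] norm_ge_zero order_trans by blast
      then have K0: "K \<ge> 0" using True by (simp add: zero_le_divide_iff)
      have "norm (g w) powr p \<le> (K / norm w) powr p"
        using K[OF True] p by (intro powr_mono2) auto
      also have "\<dots> = K powr p * norm w powr (- p)"
        using K0 by (simp add: powr_divide powr_minus_divide)
      finally have "pi * (norm w)\<^sup>2 * norm (g w) powr p \<le> pi * (norm w)\<^sup>2 * (K powr p * norm w powr (- p))"
        by (intro mult_left_mono) auto
      also have "\<dots> = pi * K powr p * (norm w powr 2 * norm w powr (- p))"
        using True by simp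
      also have "norm w powr 2 * norm w powr (- p) = norm (w - 0) powr (- (p - 2))"
        by (simp only: diff_zero powr_add[symmetric] minus_diff_eq add_uminus_conv_diff)
      finally have "ennreal (pi * (norm w)\<^sup>2 * norm (g w) powr p) \<le> ennreal (pi * K powr p) * ennreal (norm (w - 0) powr (- (p - 2)))"
        by (subst ennreal_mult[symmetric]) (auto intro: ennreal_leI)
      then show ?thesis using True by simp
    qed auto
  qed
  also have "\<dots> = ennreal (pi * K powr p) * (\<integral>\<^sup>+w. (ennreal (norm (w - 0) powr (- (p - 2))) * indicator (ball (0::complex) 1 - {0}) w) \<partial>lborel)"
    by (rule nn_integral_cmult) measurable
  also have "\<dots> < \<infinity>"
    using nn_integral_norm_powr_finite[of "p - 2" 1 0] p by (simp add: ennreal_mult_less_top)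
  finally show ?thesis
    using bergman_space_hartogs_lift_iff[OF g, of p] p by simp
qed

section \<open>The Friedrichs operator has finite rank\<close>

lemma axis_monomial_bergman:
  assumes "2 \<le> p" "p < 4"
  shows "axis_monomial m \<in> bergman_space p hartogs_triangle"
  unfolding axis_monomial_def
  by (rule hartogs_lift_bergman[where K = 1])
     (use assms in \<open>auto intro!: holomorphic_intros simp: norm_divide norm_power divide_right_mono power_le_one\<close>)

text \<open>The pairing of coefficients in \<open>integral_bergman_mult\<close> reverses the order of the exponents
  \<open>-1, 0, 1\<close>, hence the index \<open>2 - m\<close>; the weights convert between the volume and the squared norm of
  the \<open>m\<close>-th monomial.\<close>

definition friedrichs_coeff :: "(complex \<times> complex \<Rightarrow> complex) \<Rightarrow> nat \<Rightarrow> complex" where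
  "friedrichs_coeff g m = of_real (axis_weight 1 / axis_weight m) * cnj (axis_coeff g (2 - m))"

definition axis_polynomial :: "(nat \<Rightarrow> complex) \<Rightarrow> complex \<times> complex \<Rightarrow> complex" where
  "axis_polynomial \<kappa> = hartogs_lift (\<lambda>w. \<Sum>m\<le>2. \<kappa> m * (w ^ m / w))"

lemma axis_polynomial_eq: "axis_polynomial \<kappa> p = (\<Sum>m\<le>2. \<kappa> m * axis_monomial m p)"
  by (simp add: axis_polynomial_def axis_monomial_def hartogs_lift_def)

lemma norm_axis_polynomial_le:
  "norm (axis_polynomial \<kappa> p) \<le> (\<Sum>m\<le>2. norm (\<kappa> m)) * norm (axis_monomial 0 p)"
proof (cases "p \<in> hartogs_triangle")
  case True
  have "norm (axis_polynomial \<kappa> p) \<le> (\<Sum>m\<le>2. norm (\<kappa> m * axis_monomial m p))"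
    unfolding axis_polynomial_eq by (rule norm_sum)
  also have "\<dots> \<le> (\<Sum>m\<le>2. norm (\<kappa> m) * norm (axis_monomial 0 p))"
  proof (rule sum_mono)
    fix m
    have "norm (snd p) ^ m \<le> 1" using True by (intro power_le_one) (auto simp: hartogs_triangle_def)
    then show "norm (\<kappa> m * axis_monomial m p) \<le> norm (\<kappa> m) * norm (axis_monomial 0 p)"
      using True by (auto simp: norm_mult axis_monomial_def hartogs_lift_def norm_divide norm_power intro!: mult_left_le divide_right_mono)
  qed
  finally show ?thesis by (simp add: sum_distrib_right)
qed (simp add: axis_polynomial_def axis_monomial_def hartogs_lift_def)

lemma axis_polynomial_bergman:
  assumes p: "2 \<le> p" "p < 4"
  shows "axis_polynomial \<kappa> \<in> bergman_space p hartogs_triangle"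
  unfolding axis_polynomial_def
proof (rule hartogs_lift_bergman[OF _ _ p])
  show "(\<lambda>w. \<Sum>m\<le>2. \<kappa> m * (w ^ m / w)) holomorphic_on ball 0 1 - {0}"
    by (intro holomorphic_intros) auto
  fix w :: complex assume w: "w \<in> ball 0 1 - {0}"
  show "norm (\<Sum>m\<le>2. \<kappa> m * (w ^ m / w)) \<le> (\<Sum>m\<le>2. norm (\<kappa> m)) / norm w"
    using norm_axis_polynomial_le[of \<kappa> "(0, w)"] w
    by (simp add: axis_polynomial_def axis_monomial_def hartogs_lift_def hartogs_triangle_iff norm_divide)
qed

text \<open>Both sides of the orthogonality relation are evaluated by the two integral formulas, and the
  coefficients are chosen so that they agree for every \<open>f\<close>.\<close>

lemma friedrichs_operator_eq:
  assumes g: "g \<in> bergman_space 2 hartogs_triangle"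
  shows "friedrichs_operator hartogs_triangle g = axis_polynomial (friedrichs_coeff g)"
  unfolding friedrichs_operator_def
proof (rule bergman_projection_eqI[OF open_hartogs_triangle])
  note g' = bergman_spaceD[OF g]
  show "continuous_on hartogs_triangle (\<lambda>z. cnj (g z))" "(\<lambda>z. cnj (g z)) \<in> Lp_space 2 hartogs_triangle"
    using Lp_space_2_cnj[OF open_hartogs_triangle g'(2,3)] by auto
  show "axis_polynomial (friedrichs_coeff g) \<in> bergman_space 2 hartogs_triangle"
    by (rule axis_polynomial_bergman) auto
  fix f assume f: "f \<in> bergman_space 2 hartogs_triangle"
  note f' = bergman_spaceD[OF f]
  have e: "axis_monomial m \<in> bergman_space 2 hartogs_triangle" for m by (rule axis_monomial_bergman) auto
  have cn: "(LINT z:hartogs_triangle|lborel. cnj (k z)) = cnj (LINT z:hartogs_triangle|lborel. k z)" for k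
    unfolding set_lebesgue_integral_def by (subst Bochner_Integration.integral_cnj[symmetric]) simp
  have "(LINT z:hartogs_triangle|lborel. cnj (g z) * cnj (f z)) = cnj (LINT z:hartogs_triangle|lborel. g z * f z)"
    unfolding cn[symmetric] by simp
  also have "\<dots> = of_real (axis_weight 1) * (\<Sum>m\<le>2. cnj (axis_coeff f m) * cnj (axis_coeff g (2 - m)))"
    unfolding integral_bergman_mult[OF g f]
    by (simp add: atMost_atLeast0 numeral_2_eq_2 algebra_simps)
  also have "\<dots> = (\<Sum>m\<le>2. friedrichs_coeff g m * cnj (of_real (axis_weight m) * axis_coeff f m))"
    using axis_weight_pos[THEN less_imp_neq]
    unfolding sum_distrib_left by (intro sum.cong) (auto simp: friedrichs_coeff_def field_simps)
  also have "\<dots> = (\<Sum>m\<le>2. friedrichs_coeff g m * (LINT z:hartogs_triangle|lborel. axis_monomial m z * cnj (f z)))"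
  proof (intro sum.cong refl)
    fix m
    have "cnj (of_real (axis_weight m) * axis_coeff f m) = cnj (LINT z:hartogs_triangle|lborel. f z * cnj (axis_monomial m z))"
      unfolding integral_bergman_cnj_monomial[OF f e] ..
    also have "\<dots> = (LINT z:hartogs_triangle|lborel. axis_monomial m z * cnj (f z))"
      unfolding cn[symmetric] by (simp add: mult.commute)
    finally show "friedrichs_coeff g m * cnj (of_real (axis_weight m) * axis_coeff f m) = friedrichs_coeff g m * (LINT z:hartogs_triangle|lborel. axis_monomial m z * cnj (f z))"
      by simp
  qed
  also have "\<dots> = (\<Sum>m\<le>2. (LINT z:hartogs_triangle|lborel. friedrichs_coeff g m * (axis_monomial m z * cnj (f z))))"
    by simp
  also have "\<dots> = (LINT z:hartogs_triangle|lborel. (\<Sum>m\<le>2. friedrichs_coeff g m * (axis_monomial m z * cnj (f z))))"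
  proof -
    have "set_integrable lborel hartogs_triangle (\<lambda>z. friedrichs_coeff g m * (axis_monomial m z * cnj (f z)))" for m
      using set_integrable_hartogs_mult[OF bergman_spaceD(3,2)[OF e] Lp_space_2_cnj[OF open_hartogs_triangle f'(2,3)]]
      by simp
    then show ?thesis
      unfolding set_lebesgue_integral_def set_integrable_def scaleR_sum_right
      by (rule Bochner_Integration.integral_sum[symmetric])
  qed
  also have "\<dots> = (LINT z:hartogs_triangle|lborel. axis_polynomial (friedrichs_coeff g) z * cnj (f z))"
    by (simp add: axis_polynomial_eq sum_distrib_right mult.assoc)
  finally show "(LINT z:hartogs_triangle|lborel. cnj (g z) * cnj (f z)) = (LINT z:hartogs_triangle|lborel. axis_polynomial (friedrichs_coeff g) z * cnj (f z))" .
qed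

text \<open>Laurent coefficients are inner products with monomials, hence bounded functionals by the
  Cauchy-Schwarz inequality.\<close>

lemma norm_axis_coeff_le:
  assumes g: "g \<in> bergman_space 2 hartogs_triangle"
  shows "norm (axis_coeff g m) \<le> Lp_norm 2 hartogs_triangle (axis_monomial m) / axis_weight m * Lp_norm 2 hartogs_triangle g"
proof -
  have e: "axis_monomial m \<in> bergman_space 2 hartogs_triangle" by (rule axis_monomial_bergman) auto
  note ce = Lp_space_2_cnj[OF open_hartogs_triangle bergman_spaceD(2,3)[OF e]]
  have "axis_weight m * norm (axis_coeff g m) = norm (LINT p:hartogs_triangle|lborel. g p * cnj (axis_monomial m p))"
    unfolding integral_bergman_cnj_monomial[OF g e] using axis_weight_pos[of m] by (simp add: norm_mult)
  also have "\<dots> \<le> Lp_norm 2 hartogs_triangle g * Lp_norm 2 hartogs_triangle (\<lambda>p. cnj (axis_monomial m p))"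
    by (rule Cauchy_Schwarz_L2[OF open_hartogs_triangle bergman_spaceD(2,3)[OF g] ce(2,1)])
  also have "Lp_norm 2 hartogs_triangle (\<lambda>p. cnj (axis_monomial m p)) = Lp_norm 2 hartogs_triangle (axis_monomial m)"
    by (simp add: Lp_norm_def)
  finally show ?thesis using axis_weight_pos[of m] by (simp add: field_simps)
qed

lemma bounded_friedrichs_operator:
  assumes p: "2 \<le> p" "p < 4"
  shows "bounded_operator
              (bergman_space 2 hartogs_triangle) (Lp_norm 2 hartogs_triangle)
              (bergman_space p hartogs_triangle) (Lp_norm p hartogs_triangle)
              (friedrichs_operator hartogs_triangle)"
proof -
  let ?N = "Lp_norm 2 hartogs_triangle"
  \<comment> \<open>The constant must not depend on \<open>g\<close>: it collects the bounds on the coefficient functionals and the norm of \<open>1/z\<^sub>2\<close>.\<close>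
  define c where "c = (\<lambda>m. axis_weight 1 / axis_weight m * (?N (axis_monomial (2 - m)) / axis_weight (2 - m)))"
  define C where "C = (\<Sum>m\<le>2. c m) * Lp_norm p hartogs_triangle (axis_monomial 0)"
  have e0: "axis_monomial 0 \<in> bergman_space p hartogs_triangle" by (rule axis_monomial_bergman[OF p])
  have F: "axis_polynomial \<kappa> \<in> bergman_space p hartogs_triangle" for \<kappa> by (rule axis_polynomial_bergman[OF p])
  have bound: "Lp_norm p hartogs_triangle (friedrichs_operator hartogs_triangle g) \<le> C * ?N g"
    if g: "g \<in> bergman_space 2 hartogs_triangle" for g
  proof -
    have "Lp_norm p hartogs_triangle (friedrichs_operator hartogs_triangle g)
      \<le> (\<Sum>m\<le>2. norm (friedrichs_coeff g m)) * Lp_norm p hartogs_triangle (axis_monomial 0)"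
      unfolding friedrichs_operator_eq[OF g]
      by (rule Lp_norm_le[OF open_hartogs_triangle bergman_spaceD(2,3)[OF F] bergman_spaceD(2,3)[OF e0]])
         (use p in \<open>auto intro!: sum_nonneg norm_axis_polynomial_le\<close>)
    also have "\<dots> \<le> (\<Sum>m\<le>2. c m * ?N g) * Lp_norm p hartogs_triangle (axis_monomial 0)"
    proof (intro mult_right_mono sum_mono)
      fix m
      have "norm (friedrichs_coeff g m) = axis_weight 1 / axis_weight m * norm (axis_coeff g (2 - m))"
        using axis_weight_pos[of 1] axis_weight_pos[of m] by (simp add: friedrichs_coeff_def norm_mult norm_divide)
      also have "\<dots> \<le> axis_weight 1 / axis_weight m * (?N (axis_monomial (2 - m)) / axis_weight (2 - m) * ?N g)"
        using axis_weight_pos[of 1] axis_weight_pos[of m] by (intro mult_left_mono norm_axis_coeff_le[OF g]) auto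
      also have "\<dots> = c m * ?N g" by (simp add: c_def)
      finally show "norm (friedrichs_coeff g m) \<le> c m * ?N g" .
    qed (simp add: Lp_norm_def)
    also have "\<dots> = C * ?N g"
      unfolding C_def sum_distrib_right[symmetric] by (simp only: mult_ac)
    finally show ?thesis .
  qed
  show ?thesis
    unfolding bounded_operator_def
    using bound F by (auto simp: friedrichs_operator_eq)
qed

section \<open>Square-integrable holomorphic functions of no higher integrability\<close>

text \<open>At the boundary point \<open>1\<close> the unit disc contains disjoint discs of radius \<open>1 / 4 / 2 ^ k\<close> at distance
  comparable to \<open>1 / 2 ^ k\<close>. Since the integrand is of order \<open>4 ^ k\<close> there, each of them contributes at
  least a fixed amount.\<close>

lemma nn_integral_norm_powr_tangent_infinite:
  "(\<integral>\<^sup>+w. ennreal (pi * (norm w)\<^sup>2 * norm (1 - w) powr (-2)) * indicator (ball (0::complex) 1 - {0}) w \<partial>lborel) = \<infinity>" (is "?I = _")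
proof (rule ccontr)
  assume fin: "?I \<noteq> \<infinity>"
  define \<nu> where "\<nu> = density lborel (\<lambda>w. ennreal (pi * (norm w)\<^sup>2 * norm (1 - w) powr (-2)) * indicator (ball (0::complex) 1 - {0}) w)"
  \<comment> \<open>Taking \<open>Suc k\<close> keeps the discs away from \<open>0\<close>, where the factor \<open>(norm w)\<^sup>2\<close> degenerates.\<close>
  define S where "S = (\<lambda>k::nat. ball (of_real (1 - 3 / 4 / 2 ^ Suc k)) (1 / 4 / 2 ^ Suc k) :: complex set)"
  have em: "emeasure \<nu> A = (\<integral>\<^sup>+w. ennreal (pi * (norm w)\<^sup>2 * norm (1 - w) powr (-2)) * indicator (ball 0 1 - {0}) w * indicator A w \<partial>lborel)" if "A \<in> sets borel" for A
  proof -
    have [measurable]: "(\<lambda>w::complex. norm (1 - w)) \<in> borel_measurable borel" "(\<lambda>w::complex. norm w) \<in> borel_measurable borel"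
      by (intro borel_measurable_continuous_onI continuous_intros)+
    have [measurable]: "ball (0::complex) 1 - {0} \<in> sets borel" by auto
    have m: "(\<lambda>w::complex. ennreal (pi * (norm w)\<^sup>2 * norm (1 - w) powr (-2)) * indicator (ball 0 1 - {0}) w) \<in> borel_measurable lborel"
      by measurable
    show ?thesis unfolding \<nu>_def by (rule emeasure_density[OF m]) (use that in simp)
  qed
  have S: "1 / 2 / 2 ^ Suc k < norm (1 - w)" "norm (1 - w) < 1 / 2 ^ Suc k" "1 / 2 < norm w" "norm w < 1" if w: "w \<in> S k" for k w
  proof -
    define a where "a = (1 / 2 ^ Suc k :: real)"
    have a: "0 < a" "a \<le> 1 / 2"
      by (auto simp: a_def divide_simps)
    have d: "norm (of_real (1 - 3 / 4 * a) - w) < a / 4"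
      using w by (simp add: S_def a_def dist_norm)
    have *: "1 - w = of_real (3 / 4 * a) + (of_real (1 - 3 / 4 * a) - w)" by simp
    have n1: "norm (of_real (3 / 4 * a) :: complex) = 3 / 4 * a" and n2: "norm (of_real (1 - 3 / 4 * a) :: complex) = 1 - 3 / 4 * a"
      using a by (simp_all only: norm_of_real)
    have "norm (1 - w) \<le> 3 / 4 * a + norm (of_real (1 - 3 / 4 * a) - w)"
      using norm_triangle_ineq[of "of_real (3 / 4 * a)" "of_real (1 - 3 / 4 * a) - w"] n1 * by metis
    moreover have "3 / 4 * a - norm (of_real (1 - 3 / 4 * a) - w) \<le> norm (1 - w)"
      using norm_diff_ineq[of "of_real (3 / 4 * a)" "of_real (1 - 3 / 4 * a) - w"] n1 * by metis
    moreover have "norm w \<le> 1 - 3 / 4 * a + norm (of_real (1 - 3 / 4 * a) - w)"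
      using norm_triangle_ineq4[of "of_real (1 - 3 / 4 * a)" "of_real (1 - 3 / 4 * a) - w"] n2 by simp
    moreover have "1 - 3 / 4 * a \<le> norm w + norm (of_real (1 - 3 / 4 * a) - w)"
      using norm_triangle_ineq[of w "of_real (1 - 3 / 4 * a) - w"] n2 by simp
    ultimately have "a / 2 < norm (1 - w)" "norm (1 - w) < a" "1 / 2 < norm w" "norm w < 1"
      using d a by linarith+
    then show "1 / 2 / 2 ^ Suc k < norm (1 - w)" "norm (1 - w) < 1 / 2 ^ Suc k" "1 / 2 < norm w" "norm w < 1" by (auto simp: a_def)
  qed
  have disj: "disjoint_family S"
  proof -
    have "S j \<inter> S k = {}" if "j < k" for j k
    proof (rule ccontr)
      assume "S j \<inter> S k \<noteq> {}"
      then obtain w where w: "w \<in> S j" "w \<in> S k" by auto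
      have "(2::real) ^ Suc (Suc j) \<le> 2 ^ Suc k" using that by (intro power_increasing) auto
      then have "1 / 2 ^ Suc k \<le> 1 / (2::real) ^ Suc (Suc j)" by (intro divide_left_mono) auto
      then show False using S(1)[OF w(1)] S(2)[OF w(2)] by simp
    qed
    then show ?thesis unfolding disjoint_family_on_def by (metis Int_commute linorder_neqE_nat)
  qed
  have low: "ennreal (1 / 32) \<le> emeasure \<nu> (S k)" for k
  proof -
    define a where "a = (1 / 2 ^ Suc k :: real)"
    have a: "0 < a" by (simp add: a_def)
    have "ennreal (1/32) \<le> ennreal (1 / (4 * a\<^sup>2)) * ennreal (pi * (a / 4)\<^sup>2) "
      using a pi_gt3 by (subst ennreal_mult[symmetric]) (auto intro!: ennreal_leI simp: field_simps power2_eq_square)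
    also have "\<dots> = (\<integral>\<^sup>+w. ennreal (1 / (4 * a\<^sup>2)) * indicator (S k) w \<partial>lborel)"
      using a by (subst nn_integral_cmult_indicator) (auto simp: S_def a_def emeasure_disc)
    also have "\<dots> \<le> emeasure \<nu> (S k)"
    proof (subst em, simp add: S_def, rule nn_integral_mono)
      fix w
      show "ennreal (1 / (4 * a\<^sup>2)) * indicator (S k) w \<le> ennreal (pi * (norm w)\<^sup>2 * norm (1 - w) powr (-2)) * indicator (ball 0 1 - {0}) w * indicator (S k) w"
      proof (cases "w \<in> S k")
        case True
        have Sw: "a / 2 < norm (1 - w)" "norm (1 - w) < a" "1 / 2 < norm w" "norm w < 1"
          using S[OF True] by (simp_all add: a_def)
        have "(1/2)\<^sup>2 \<le> (norm w)\<^sup>2" using Sw by (intro power_mono) auto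
        moreover have "1 * (norm w)\<^sup>2 \<le> pi * (norm w)\<^sup>2" using pi_gt3 by (intro mult_right_mono) auto
        ultimately have 1: "1 / 4 \<le> pi * (norm w)\<^sup>2" by (simp add: power2_eq_square)
        have pos: "0 < norm (1 - w)" using Sw(1) a by linarith
        have "(norm (1 - w))\<^sup>2 \<le> a\<^sup>2" using Sw(2) by (intro power_mono) auto
        then have "1 / a\<^sup>2 \<le> 1 / (norm (1 - w))\<^sup>2" using pos a by (intro divide_left_mono) auto
        also have "\<dots> = norm (1 - w) powr (-2)" using pos by (simp add: powr_minus_divide)
        finally have "1 / 4 * (1 / a\<^sup>2) \<le> pi * (norm w)\<^sup>2 * norm (1 - w) powr (-2)"
          using 1 by (intro mult_mono) auto
        then have "ennreal (1 / (4 * a\<^sup>2)) \<le> ennreal (pi * (norm w)\<^sup>2 * norm (1 - w) powr (-2))"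
          by (intro ennreal_leI) simp
        moreover have "w \<in> ball 0 1 - {0}" using Sw by auto
        ultimately show ?thesis using True by simp
      qed auto
    qed
    finally show ?thesis .
  qed
  obtain x where x: "?I = ennreal x" "x \<ge> 0" using fin by (cases ?I) auto
  obtain n :: nat where n: "x < real n * (1 / 32)" using reals_Archimedean3[of "1/32"] by auto
  have "ennreal (real n * (1 / 32)) = (\<Sum>k<n. ennreal (1 / 32))" by (subst sum_ennreal) auto
  also have "\<dots> \<le> (\<Sum>k<n. emeasure \<nu> (S k))" by (rule sum_mono) (rule low)
  also have "\<dots> = emeasure \<nu> (\<Union>k<n. S k)"
    using disj by (intro sum_emeasure) (auto simp: \<nu>_def S_def disjoint_family_on_def)
  also have "\<dots> \<le> ?I"
    by (subst em) (auto simp: S_def intro!: nn_integral_mono split: split_indicator)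
  finally show False using n x by simp
qed

text \<open>The witness is \<open>(1 - z\<^sub>2) powr (- 2 / p)\<close>. Its square has exponent \<open>4 / p < 2\<close>, which is integrable
  near a point of the plane, whereas its \<open>p\<close>-th power has the critical exponent \<open>2\<close>.\<close>

lemma bergman_space_2_not_subset:
  assumes p: "p > 2"
  obtains f where "f \<in> bergman_space 2 hartogs_triangle" "f \<notin> bergman_space p hartogs_triangle"
proof
  define g where "g = (\<lambda>w. exp (of_real (- (2 / p)) * Ln (1 - w)))"
  have nz: "1 - w \<noteq> 0" "1 - w \<notin> \<real>\<^sub>\<le>\<^sub>0" if "w \<in> ball 0 1 - {0}" for w :: complex
  proof -
    have "Re w < 1" using that complex_Re_le_cmod[of w] by simp
    then show "1 - w \<notin> \<real>\<^sub>\<le>\<^sub>0" by (auto simp: complex_nonpos_Reals_iff)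
    then show "1 - w \<noteq> 0" by auto
  qed
  have hol: "g holomorphic_on ball 0 1 - {0}"
    unfolding g_def using nz by (intro holomorphic_intros) auto
  have ng: "norm (g w) = norm (1 - w) powr (- (2 / p))" if "w \<in> ball 0 1 - {0}" for w
    using nz[OF that] by (simp add: g_def powr_def)
  have "(\<integral>\<^sup>+w. ennreal (pi * (norm w)\<^sup>2 * norm (g w) powr 2) * indicator (ball (0::complex) 1 - {0}) w \<partial>lborel)
    \<le> (\<integral>\<^sup>+w. ennreal pi * (ennreal (norm (w - 1) powr (- (4 / p))) * indicator (ball (1::complex) 2 - {1}) w) \<partial>lborel)"
  proof (rule nn_integral_mono)
    fix w :: complex
    show "ennreal (pi * (norm w)\<^sup>2 * norm (g w) powr 2) * indicator (ball (0::complex) 1 - {0}) w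
      \<le> ennreal pi * (ennreal (norm (w - 1) powr (- (4 / p))) * indicator (ball (1::complex) 2 - {1}) w)"
    proof (cases "w \<in> ball 0 1 - {0}")
      case True
      have "norm (1 - w) < 2" using True norm_triangle_ineq4[of 1 w] by simp
      then have w: "w \<in> ball 1 2 - {1}" using nz[OF True] by (auto simp: dist_norm)
      have "norm (g w) powr 2 = norm (w - 1) powr (- (4 / p))"
        unfolding ng[OF True] powr_powr by (simp add: norm_minus_commute)
      moreover have "(norm w)\<^sup>2 \<le> 1" using True by (simp add: power_le_one)
      ultimately have "pi * (norm w)\<^sup>2 * norm (g w) powr 2 \<le> pi * 1 * norm (w - 1) powr (- (4 / p))"
        by (intro mult_mono) auto
      then show ?thesis using True w by (simp add: ennreal_mult[symmetric] ennreal_leI)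
    qed auto
  qed
  also have "\<dots> = ennreal pi * (\<integral>\<^sup>+w. ennreal (norm (w - 1) powr (- (4 / p))) * indicator (ball (1::complex) 2 - {1}) w \<partial>lborel)"
  proof (rule nn_integral_cmult)
    have [measurable]: "(\<lambda>w::complex. norm (w - 1)) \<in> borel_measurable borel"
      by (intro borel_measurable_continuous_onI continuous_intros)
    have [measurable]: "ball (1::complex) 2 - {1} \<in> sets borel" by auto
    show "(\<lambda>w::complex. ennreal (norm (w - 1) powr (- (4 / p))) * indicator (ball (1::complex) 2 - {1}) w) \<in> borel_measurable lborel"
      by measurable
  qed
  also have "\<dots> < \<infinity>"
    using nn_integral_norm_powr_finite[of "4 / p" 2 1] p by (simp add: ennreal_mult_less_top divide_simps)
  finally show "hartogs_lift g \<in> bergman_space 2 hartogs_triangle"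
    using bergman_space_hartogs_lift_iff[OF hol, of 2] by simp
  have "(\<integral>\<^sup>+w. ennreal (pi * (norm w)\<^sup>2 * norm (g w) powr p) * indicator (ball (0::complex) 1 - {0}) w \<partial>lborel)
    = (\<integral>\<^sup>+w. ennreal (pi * (norm w)\<^sup>2 * norm (1 - w) powr (-2)) * indicator (ball (0::complex) 1 - {0}) w \<partial>lborel)"
  proof (rule nn_integral_cong)
    fix w :: complex
    show "ennreal (pi * (norm w)\<^sup>2 * norm (g w) powr p) * indicator (ball (0::complex) 1 - {0}) w = ennreal (pi * (norm w)\<^sup>2 * norm (1 - w) powr (-2)) * indicator (ball (0::complex) 1 - {0}) w"
      using p by (cases "w \<in> ball 0 1 - {0}") (auto simp: ng powr_powr)
  qed
  then show "hartogs_lift g \<notin> bergman_space p hartogs_triangle"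
    using bergman_space_hartogs_lift_iff[OF hol, of p] nn_integral_norm_powr_tangent_infinite p by simp
qed

theorem proposition1p5:
  shows "(\<forall>p::real. 2 \<le> p \<and> p < 4 \<longrightarrow>
            bounded_operator
              (bergman_space 2 hartogs_triangle) (Lp_norm 2 hartogs_triangle)
              (bergman_space p hartogs_triangle) (Lp_norm p hartogs_triangle)
              (friedrichs_operator hartogs_triangle)) \<and>
         (\<forall>p::real. p > 2 \<longrightarrow>
            \<not> bergman_projection hartogs_triangle ` Lp_space 2 hartogs_triangle
                \<subseteq> bergman_space p hartogs_triangle)"
proof (intro conjI allI impI)
  fix p :: real assume "2 \<le> p \<and> p < 4"
  then show "bounded_operator
              (bergman_space 2 hartogs_triangle) (Lp_norm 2 hartogs_triangle)
              (bergman_space p hartogs_triangle) (Lp_norm p hartogs_triangle)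
              (friedrichs_operator hartogs_triangle)"
    by (intro bounded_friedrichs_operator) auto
next
  fix p :: real assume "p > 2"
  then obtain f where f: "f \<in> bergman_space 2 hartogs_triangle" "f \<notin> bergman_space p hartogs_triangle"
    by (rule bergman_space_2_not_subset)
  moreover have "f \<in> Lp_space 2 hartogs_triangle" using bergman_spaceD(3)[OF f(1)] .
  moreover have "bergman_projection hartogs_triangle f = f"
    by (rule bergman_projection_bergman_space[OF open_hartogs_triangle f(1)])
  ultimately show "\<not> bergman_projection hartogs_triangle ` Lp_space 2 hartogs_triangle
                \<subseteq> bergman_space p hartogs_triangle"
    by force
qed

end
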